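(* Let $T$ be a nondegenerate convex tiling of a convex polygon $R$, and consider the set of tilings of $R$ which are combinatorially equivalent to $T$, have the same edge directions as $T$, and have the same tile orientations as $T$. Then for any given assignment of areas to the tiles, there is at most one such tiling whose tiles have these areas.
   Context: A tiling of a polygon $R\subset\mathbb{R}^2$ is a covering of $R$ by finitely many convex polygons (tiles) with pairwise disjoint interiors (not necessarily edge-to-edge). It is nondegenerate if every vertex of every tile, other than the convex corners of $R$, lies in the relative interior of a straight segment of the union of tile boundaries (a "T"-junction, possibly with several legs). Its associated bipartite planar graph has a white vertex for each tile, a black vertex for each maximal line segment in the union of tile boundaries, and an edge $wb$ when tile $w$ has an edge contained in segment $b$; black vertices from segments on $\partial R$ are boundary vertices, each corresponding to an edge of $R$. Two tilings of $R$ are combinatorially equivalent if their associated graphs are isomorphic by a color-preserving isomorphism fixing each boundary vertex; "same edge directions" means corresponding tile edges are parallel. For a tile $t$ with counterclockwise edge vectors $z_1,\dots,z_n$, a combinatorially equivalent tile with the same edge directions has edge vectors $a_1z_1,\dots,a_nz_n$ with the real numbers $a_i$ all positive or all negative; its orientation (relative to $t$) is $+$ in the first case and $-$ in the second (a change of orientation corresponds to a rotation by $\pi$). *)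

theory Defs
  imports "HOL-Analysis.Analysis"
begin

definition convex_polygon :: "(real^2) set \<Rightarrow> bool" where
  "convex_polygon P \<longleftrightarrow> polytope P \<and> interior P \<noteq> {}"

definition tiling :: "(real^2) set \<Rightarrow> (real^2) set set \<Rightarrow> bool" where
  "tiling R T \<longleftrightarrow> finite T \<and> (\<forall>t\<in>T. convex_polygon t) \<and> \<Union>T = R \<and>
     pairwise (\<lambda>s t. interior s \<inter> interior t = {}) T"

definition skeleton :: "(real^2) set set \<Rightarrow> (real^2) set" where
  "skeleton T = (\<Union>t\<in>T. frontier t)"

text \<open>The convex corners of a convex polygon \<open>R\<close> are exactly its extreme points.\<close>

definition nondegenerate :: "(real^2) set \<Rightarrow> (real^2) set set \<Rightarrow> bool" where
  "nondegenerate R T \<longleftrightarrow>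
     (\<forall>t\<in>T. \<forall>v. v extreme_point_of t \<and> \<not> v extreme_point_of R \<longrightarrow>
        (\<exists>a b. v \<in> open_segment a b \<and> closed_segment a b \<subseteq> skeleton T))"

text \<open>The associated bipartite graph of a tiling \<open>T\<close>: white vertices are the elements of \<open>T\<close>,
  black vertices the elements of \<open>maximal_segments T\<close>, and \<open>adjacent\<close> is the edge relation.
  A line contains at most one edge of a convex polygon, so there are no multiple edges.\<close>

definition maximal_segments :: "(real^2) set set \<Rightarrow> (real^2) set set" where
  "maximal_segments T =
     {s. (\<exists>a b. a \<noteq> b \<and> s = closed_segment a b) \<and> s \<subseteq> skeleton T \<and>
         (\<forall>c d. s \<subseteq> closed_segment c d \<and> closed_segment c d \<subseteq> skeleton T \<longrightarrow> closed_segment c d = s)}"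

definition adjacent :: "(real^2) set \<Rightarrow> (real^2) set \<Rightarrow> bool" where
  "adjacent t s \<longleftrightarrow> (\<exists>e. e edge_of t \<and> e \<subseteq> s)"

text \<open>A colour-preserving isomorphism from the graph of \<open>T\<close> to that of \<open>T'\<close>: \<open>f\<close> acts on
  white and \<open>g\<close> on black vertices. Since \<open>R\<close> is convex, the maximal segments contained in
  its frontier are the edges of \<open>R\<close> themselves, so fixing the boundary vertices amounts to \<open>g s = s\<close>.\<close>

definition combinatorial_equivalence ::
  "(real^2) set \<Rightarrow> (real^2) set set \<Rightarrow> (real^2) set set \<Rightarrow>
   ((real^2) set \<Rightarrow> (real^2) set) \<Rightarrow> ((real^2) set \<Rightarrow> (real^2) set) \<Rightarrow> bool" where
  "combinatorial_equivalence R T T' f g \<longleftrightarrow>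
     bij_betw f T T' \<and> bij_betw g (maximal_segments T) (maximal_segments T') \<and>
     (\<forall>t\<in>T. \<forall>s\<in>maximal_segments T. adjacent t s \<longleftrightarrow> adjacent (f t) (g s)) \<and>
     (\<forall>s\<in>maximal_segments T. s \<subseteq> frontier R \<longrightarrow> g s = s)"

definition cross2 :: "real^2 \<Rightarrow> real^2 \<Rightarrow> real" where
  "cross2 u v = u $ 1 * v $ 2 - u $ 2 * v $ 1"

text \<open>\<open>z\<close> is the vector of the edge \<open>e\<close> of \<open>t\<close> traversed counterclockwise,
  i.e. with \<open>t\<close> on its left.\<close>

definition ccw_edge_vector :: "(real^2) set \<Rightarrow> (real^2) set \<Rightarrow> real^2 \<Rightarrow> bool" where
  "ccw_edge_vector t e z \<longleftrightarrow>
     e edge_of t \<and> (\<exists>a. e = closed_segment a (a + z) \<and> (\<forall>x\<in>t. cross2 z (x - a) \<ge> 0))"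

text \<open>The edge of \<open>t\<close> in the segment \<open>s\<close> corresponds to the edge of \<open>f t\<close> in \<open>g s\<close>.\<close>

definition corresponding_edge_vectors ::
  "(real^2) set set \<Rightarrow> ((real^2) set \<Rightarrow> (real^2) set) \<Rightarrow> ((real^2) set \<Rightarrow> (real^2) set) \<Rightarrow>
   (real^2) set \<Rightarrow> real^2 \<Rightarrow> real^2 \<Rightarrow> bool" where
  "corresponding_edge_vectors T f g t z z' \<longleftrightarrow>
     (\<exists>s\<in>maximal_segments T. \<exists>e e'.
        e \<subseteq> s \<and> ccw_edge_vector t e z \<and> e' \<subseteq> g s \<and> ccw_edge_vector (f t) e' z')"

definition same_edge_directions ::
  "(real^2) set set \<Rightarrow> ((real^2) set \<Rightarrow> (real^2) set) \<Rightarrow> ((real^2) set \<Rightarrow> (real^2) set) \<Rightarrow> bool" where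
  "same_edge_directions T f g \<longleftrightarrow>
     (\<forall>t\<in>T. \<forall>z z'. corresponding_edge_vectors T f g t z z' \<longrightarrow> (\<exists>a. z' = a *\<^sub>R z))"

text \<open>Every tile has orientation \<open>+\<close> relative to the tile of \<open>T\<close> it corresponds to.\<close>

definition same_orientations ::
  "(real^2) set set \<Rightarrow> ((real^2) set \<Rightarrow> (real^2) set) \<Rightarrow> ((real^2) set \<Rightarrow> (real^2) set) \<Rightarrow> bool" where
  "same_orientations T f g \<longleftrightarrow>
     (\<forall>t\<in>T. \<forall>z z'. corresponding_edge_vectors T f g t z z' \<longrightarrow> (\<exists>a>0. z' = a *\<^sub>R z))"

end

theory Submission
  imports Defs "HOL-Probability.Distribution_Functions"
begin

text \<open>
  Let \<open>K t\<close> and \<open>L t\<close> be the tiles of the two tilings corresponding to \<open>t\<close>, and put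
  \<open>N e t = (1 - e) K t + e L t\<close>. If two tiles of the first tiling share a nontrivial segment,
  then they lie on opposite sides of a line, and the equivalence forces the corresponding tiles of
  the second tiling onto the same sides of a parallel line; hence \<open>N e s\<close> and \<open>N e t\<close> are
  separated by a line as well. If two tiles meet in at most one point, then \<open>N e s\<close> and
  \<open>N e t\<close> overlap in a set of diameter \<open>O(e)\<close>. As all \<open>N e t\<close> lie in \<open>R\<close>, their areas add up
  to at most the area of \<open>R\<close> plus \<open>O(e\<^sup>2)\<close>.

  By Brunn-Minkowski no \<open>N e t\<close> has smaller area than \<open>K t\<close>, so each of them has area at most
  \<open>area t + O(e\<^sup>2)\<close>. This is the equality case of Brunn-Minkowski, hence \<open>L t = K t + w t\<close>
  for a vector \<open>w t\<close>.

  Finally, integrate \<open>\<phi>(x) = r\<^sup>2 - |x|\<^sup>2\<close> over the tiles \<open>N e t = K t + e w t\<close>. The sum is a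
  quadratic polynomial in \<open>e\<close> with leading coefficient \<open>- (\<Sum>t. area t * |w t|\<^sup>2)\<close>, takes the same
  value at \<open>e = 0\<close> and \<open>e = 1\<close>, and by the overlap estimate exceeds its value at \<open>0\<close> by
  at most \<open>O(e\<^sup>2)\<close>; so all \<open>w t\<close> vanish.
\<close>

section \<open>Convex combinations of sets\<close>

text \<open>Written as an image of the product \<open>K \<times> L\<close>, so that compactness and
  convexity follow from the results on images and products.\<close>

definition mix :: "real \<Rightarrow> 'a::real_vector set \<Rightarrow> 'a set \<Rightarrow> 'a set" where
  "mix e K L = (\<lambda>(x, y). (1 - e) *\<^sub>R x + e *\<^sub>R y) ` (K \<times> L)"

lemma mixI: "x \<in> K \<Longrightarrow> y \<in> L \<Longrightarrow> (1 - e) *\<^sub>R x + e *\<^sub>R y \<in> mix e K L"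
  by (auto simp: mix_def)

lemma mixE:
  assumes "z \<in> mix e K L"
  obtains x y where "x \<in> K" "y \<in> L" "z = (1 - e) *\<^sub>R x + e *\<^sub>R y"
  using assms by (auto simp: mix_def)

lemma compact_mix:
  fixes K L :: "'a::real_normed_vector set"
  assumes "compact K" "compact L"
  shows "compact (mix e K L)"
  unfolding mix_def
  by (intro compact_continuous_image compact_Times assms)
     (auto intro!: continuous_intros simp: split_beta)

lemma convex_mix:
  assumes "convex K" "convex L"
  shows "convex (mix e K L)"
proof -
  have "linear (\<lambda>p::'a \<times> 'a. (1 - e) *\<^sub>R fst p + e *\<^sub>R snd p)"
    by (rule linearI) (auto simp: algebra_simps)
  then show ?thesis
    unfolding mix_def case_prod_beta by (intro convex_linear_image convex_Times assms)
qed

lemma mix_subset_convex: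
  assumes "convex R" "K \<subseteq> R" "L \<subseteq> R" "0 \<le> e" "e \<le> 1"
  shows "mix e K L \<subseteq> R"
  using assms by (auto simp: mix_def subset_eq convex_alt)

lemma mix_mono: "K \<subseteq> K' \<Longrightarrow> L \<subseteq> L' \<Longrightarrow> mix e K L \<subseteq> mix e K' L'"
  by (auto simp: mix_def)

lemma mix_linear_image:
  assumes "linear g"
  shows "mix e (g ` K) (g ` L) = g ` mix e K L"
proof -
  interpret linear g by fact
  show ?thesis
    by (force simp: mix_def add scaleR)
qed

section \<open>The one-dimensional inequality for intervals\<close>

lemma convex_bounded_real_between:
  fixes X :: "real set"
  assumes "convex X" "X \<noteq> {}" "bounded X"
  shows "{Inf X<..<Sup X} \<subseteq> X" "X \<subseteq> {Inf X..Sup X}"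
proof -
  have bd: "bdd_above X" "bdd_below X"
    using assms by (auto intro: bounded_imp_bdd_above bounded_imp_bdd_below)
  then show "X \<subseteq> {Inf X..Sup X}"
    by (auto intro: cInf_lower cSup_upper)
  show "{Inf X<..<Sup X} \<subseteq> X"
  proof
    fix x assume "x \<in> {Inf X<..<Sup X}"
    then obtain y z where "y \<in> X" "y < x" "z \<in> X" "x < z"
      using bd assms by (auto simp: less_cSup_iff cInf_less_iff)
    then show "x \<in> X"
      using assms(1) by (meson is_interval_convex_1 is_interval_1 less_imp_le)
  qed
qed

lemma emeasure_convex_bounded_real:
  fixes X :: "real set"
  assumes "convex X" "X \<noteq> {}" "bounded X"
  shows "emeasure lborel X = ennreal (Sup X - Inf X)"
proof -
  note b = convex_bounded_real_between[OF assms]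
  have le: "Inf X \<le> Sup X"
    using b(2) assms(2) by force
  have m: "X \<in> sets borel"
    using assms(1) by (simp add: is_interval_convex_1 real_interval_borel_measurable)
  have "emeasure lborel {Inf X<..<Sup X} \<le> emeasure lborel X"
       "emeasure lborel X \<le> emeasure lborel {Inf X..Sup X}"
    using b m by (auto intro: emeasure_mono)
  then show ?thesis
    using le by (simp add: antisym)
qed

text \<open>Combining two intervals combines their end points, and hence their lengths.
  \<open>Z\<close> is any Borel set above the combination: it will be a slice of a combined body, or
  a superlevel set of its chord length. Whether end points belong to the sets does not affect
  lengths, so it is enough to cover the open interval.\<close>

lemma emeasure_mix_real:
  fixes X Y Z :: "real set"
  assumes "convex X" "X \<noteq> {}" "bounded X" "convex Y" "Y \<noteq> {}" "bounded Y"
    and e: "0 < e" "e < 1" and Z: "mix e X Y \<subseteq> Z" "Z \<in> sets borel"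
  shows "ennreal (1 - e) * emeasure lborel X + ennreal e * emeasure lborel Y \<le> emeasure lborel Z"
proof -
  let ?a = "(1 - e) * Inf X + e * Inf Y" and ?b = "(1 - e) * Sup X + e * Sup Y"
  note bX = convex_bounded_real_between[OF assms(1-3)]
  note bY = convex_bounded_real_between[OF assms(4-6)]
  have le: "Inf X \<le> Sup X" "Inf Y \<le> Sup Y"
    using bX(2) bY(2) assms(2,5) by force+
  have "{?a<..<?b} \<subseteq> mix e X Y"
  proof
    fix w assume w: "w \<in> {?a<..<?b}"
    have bd: "bdd_above X" "bdd_below X" "bdd_above Y" "bdd_below Y"
      using assms by (auto intro: bounded_imp_bdd_above bounded_imp_bdd_below)
    have "\<exists>x\<in>X. \<exists>y\<in>Y. (1 - e) * x + e * y < w"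
    proof -
      \<comment> \<open>Points within \<open>d\<close> of the two infima combine to a value below
        \<open>?a + d = w\<close>.\<close>
      define d where "d = w - ?a"
      have "d > 0" using w by (simp add: d_def)
      then obtain x y where "x \<in> X" "x < Inf X + d" "y \<in> Y" "y < Inf Y + d"
        using bd assms(2,5) cInf_lessD[of X "Inf X + d"] cInf_lessD[of Y "Inf Y + d"] by auto
      moreover from this have "(1 - e) * x + e * y < (1 - e) * (Inf X + d) + e * (Inf Y + d)"
        using e by (intro add_strict_mono mult_strict_left_mono) auto
      ultimately show ?thesis
        by (intro bexI[of _ x] bexI[of _ y]) (auto simp: d_def algebra_simps)
    qed
    moreover have "\<exists>x\<in>X. \<exists>y\<in>Y. (1 - e) * x + e * y > w"
    proof -
      define d where "d = ?b - w"
      have "d > 0" using w by (simp add: d_def)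
      then obtain x y where "x \<in> X" "x > Sup X - d" "y \<in> Y" "y > Sup Y - d"
        using bd assms(2,5) less_cSupD[of X "Sup X - d"] less_cSupD[of Y "Sup Y - d"] by auto
      moreover from this have "(1 - e) * x + e * y > (1 - e) * (Sup X - d) + e * (Sup Y - d)"
        using e by (intro add_strict_mono mult_strict_left_mono) auto
      ultimately show ?thesis
        by (intro bexI[of _ x] bexI[of _ y]) (auto simp: d_def algebra_simps)
    qed
    ultimately obtain u v where "u \<in> mix e X Y" "u < w" "v \<in> mix e X Y" "w < v"
      by (auto simp: mix_def)
    moreover have "convex (mix e X Y)"
      by (intro convex_mix assms)
    ultimately show "w \<in> mix e X Y"
      by (meson is_interval_convex_1 is_interval_1 less_imp_le)
  qed
  then have "emeasure lborel {?a<..<?b} \<le> emeasure lborel Z"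
    using Z by (intro emeasure_mono) auto
  moreover have ab: "?a \<le> ?b"
    using le e by (intro add_mono mult_left_mono) auto
  moreover have "ennreal (1 - e) * emeasure lborel X + ennreal e * emeasure lborel Y = ennreal (?b - ?a)"
  proof -
    have "?b - ?a = (1 - e) * (Sup X - Inf X) + e * (Sup Y - Inf Y)"
      by (simp add: algebra_simps)
    then show ?thesis
      using e le
      by (simp add: ennreal_mult emeasure_convex_bounded_real[OF assms(1-3)]
          emeasure_convex_bounded_real[OF assms(4-6)])
  qed
  ultimately show ?thesis
    by simp
qed

section \<open>Vertical slices and Fubini's theorem in the plane\<close>

definition pt :: "real \<Rightarrow> real \<Rightarrow> real^2" where
  "pt x y = x *\<^sub>R axis 1 1 + y *\<^sub>R axis 2 1"

lemma pt_nth [simp]: "pt x y $ 1 = x" "pt x y $ 2 = y"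
  by (auto simp: pt_def axis_def)

lemma pt_eta: "pt (v $ 1) (v $ 2) = v"
  by (simp add: vec_eq_iff forall_2)

lemma pt_linear_combination: "a *\<^sub>R pt x y + b *\<^sub>R pt x' y' = pt (a * x + b * x') (a * y + b * y')"
  by (simp add: vec_eq_iff forall_2)

lemma continuous_pt: "continuous_on S (\<lambda>p. pt (fst p) (snd p))"
  unfolding pt_def by (intro continuous_intros)

lemma measurable_pt [measurable]: "(\<lambda>p. pt (fst p) (snd p)) \<in> borel_measurable (lborel \<Otimes>\<^sub>M lborel)"
  using borel_measurable_continuous_onI[OF continuous_pt] by (simp add: lborel_prod)

text \<open>Makes Fubini's theorem available on \<open>real^2\<close>: the two measures agree on
  open boxes, and these determine \<open>lborel\<close>.\<close>

lemma lborel_vec2: "(lborel :: (real^2) measure) = distr (lborel \<Otimes>\<^sub>M lborel) borel (\<lambda>p. pt (fst p) (snd p))"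
proof (rule lborel_eqI)
  fix l u :: "real^2"
  assume lu: "\<And>b. b \<in> Basis \<Longrightarrow> l \<bullet> b \<le> u \<bullet> b"
  have le: "l $ 1 \<le> u $ 1" "l $ 2 \<le> u $ 2"
    using lu[of "axis 1 1"] lu[of "axis 2 1"] by (auto simp: inner_axis axis_in_Basis_iff)
  have "(\<lambda>p. pt (fst p) (snd p)) -` box l u \<inter> space (lborel \<Otimes>\<^sub>M lborel)
      = {l$1<..<u$1} \<times> {l$2<..<u$2}"
    by (auto simp: mem_box_cart forall_2 space_pair_measure)
  then have "emeasure (distr (lborel \<Otimes>\<^sub>M lborel) borel (\<lambda>p. pt (fst p) (snd p))) (box l u)
      = ennreal ((u$1 - l$1) * (u$2 - l$2))"
    using le by (simp add: emeasure_distr lborel.emeasure_pair_measure_Times ennreal_mult)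
  also have "(u$1 - l$1) * (u$2 - l$2) = (\<Prod>b\<in>Basis. (u - l) \<bullet> b)"
  proof -
    have B: "(Basis :: (real^2) set) = {axis 1 1, axis 2 1}"
      by (auto simp: Basis_vec_def UNIV_2)
    show ?thesis
      unfolding B by (subst prod.insert) (auto simp: inner_axis axis_eq_axis)
  qed
  finally show "emeasure (distr (lborel \<Otimes>\<^sub>M lborel) borel (\<lambda>p. pt (fst p) (snd p))) (box l u)
      = ennreal (\<Prod>b\<in>Basis. (u - l) \<bullet> b)" .
qed simp

text \<open>Only vertical chords are measured. Other directions are reached by applying an
  orthogonal map to the bodies.\<close>

definition chord :: "(real^2) set \<Rightarrow> real \<Rightarrow> real" where
  "chord K x = measure lborel {y. pt x y \<in> K}"

lemma compact_slice:
  assumes "compact K" shows "compact {y. pt x y \<in> K}"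
proof -
  have eq: "{y. pt x y \<in> K} = (\<lambda>v. v $ 2) ` (K \<inter> {v. v $ 1 = x})"
  proof (intro set_eqI iffI)
    fix y assume "y \<in> {y. pt x y \<in> K}"
    then show "y \<in> (\<lambda>v. v $ 2) ` (K \<inter> {v. v $ 1 = x})"
      by (intro image_eqI[of _ _ "pt x y"]) auto
  next
    fix y assume "y \<in> (\<lambda>v. v $ 2) ` (K \<inter> {v. v $ 1 = x})"
    then show "y \<in> {y. pt x y \<in> K}"
      using pt_eta by auto
  qed
  have "closed {v::real^2. v $ 1 = x}"
    by (intro closed_Collect_eq continuous_intros)
  then show ?thesis
    unfolding eq using assms
    by (intro compact_continuous_image compact_Int_closed) (auto intro!: continuous_intros)
qed

lemma convex_slice:
  assumes "convex K" shows "convex {y. pt x y \<in> K}"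
proof (rule convexI)
  fix y z u v :: real
  assume "y \<in> {y. pt x y \<in> K}" "z \<in> {y. pt x y \<in> K}" "0 \<le> u" "0 \<le> v" "u + v = 1"
  moreover from this have "u *\<^sub>R pt x y + v *\<^sub>R pt x z \<in> K"
    by (intro convexD[OF assms]) auto
  moreover have "u *\<^sub>R pt x y + v *\<^sub>R pt x z = pt x (u * y + v * z)"
    using \<open>u + v = 1\<close> by (simp add: pt_linear_combination flip: distrib_right)
  ultimately show "u *\<^sub>R y + v *\<^sub>R z \<in> {y. pt x y \<in> K}"
    by simp
qed

lemma slice_borel [measurable]: "compact K \<Longrightarrow> {y. pt x y \<in> K} \<in> sets borel"
  by (simp add: borel_compact compact_slice)

lemma emeasure_slice:
  assumes "compact K"
  shows "emeasure lborel {y. pt x y \<in> K} = ennreal (chord K x)"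
  unfolding chord_def
  using emeasure_compact_finite[OF compact_slice[OF assms]]
  by (intro emeasure_eq_ennreal_measure) (auto simp: less_top)

lemma Fubini_compact:
  assumes "compact K"
  shows "chord K \<in> borel_measurable borel"
    "emeasure lborel K = (\<integral>\<^sup>+x. ennreal (chord K x) \<partial>lborel)"
proof -
  let ?P = "(\<lambda>p. pt (fst p) (snd p)) -` K \<inter> space (lborel \<Otimes>\<^sub>M lborel)"
  have K: "K \<in> sets borel"
    using assms by (rule borel_compact)
  then have P: "?P \<in> sets (lborel \<Otimes>\<^sub>M lborel)"
    by (intro measurable_sets[OF measurable_pt])
  have sl: "Pair x -` ?P = {y. pt x y \<in> K}" for x
    by (auto simp: space_pair_measure)
  have "emeasure lborel K = emeasure (lborel \<Otimes>\<^sub>M lborel) ?P"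
    by (subst lborel_vec2) (use K in \<open>simp add: emeasure_distr\<close>)
  also have "\<dots> = (\<integral>\<^sup>+x. emeasure lborel (Pair x -` ?P) \<partial>lborel)"
    using P by (rule lborel.emeasure_pair_measure_alt)
  finally show "emeasure lborel K = (\<integral>\<^sup>+x. ennreal (chord K x) \<partial>lborel)"
    unfolding sl by (simp add: emeasure_slice[OF assms])
  have "(\<lambda>x. emeasure lborel (Pair x -` ?P)) \<in> borel_measurable lborel"
    using P by (rule lborel.measurable_emeasure_Pair)
  then have "(\<lambda>x. enn2real (emeasure lborel (Pair x -` ?P))) \<in> borel_measurable borel"
    by simp
  then show "chord K \<in> borel_measurable borel"
    unfolding sl by (simp add: chord_def [abs_def] measure_def)
qed

section \<open>The Brunn-Minkowski inequality in the plane\<close>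

lemma chord_nonneg [simp]: "0 \<le> chord K x"
  by (simp add: chord_def)

lemma slice_nonempty: "0 < chord K x \<Longrightarrow> {y. pt x y \<in> K} \<noteq> {}"
  by (metis chord_def measure_empty less_irrefl)

lemma bounded_slice: "compact K \<Longrightarrow> bounded {y. pt x y \<in> K}"
  by (simp add: compact_imp_bounded compact_slice)

text \<open>The combination of two slices lies in a slice of the combination, so the one-dimensional
  inequality applies. Both slices have to be nonempty, since combining with an empty set gives the
  empty set, while the left side would keep the length of the other slice.\<close>

lemma chord_mix:
  assumes "compact K" "convex K" "compact L" "convex L" and e: "0 < e" "e < 1"
    and ne: "{y. pt x y \<in> K} \<noteq> {}" "{y. pt x' y \<in> L} \<noteq> {}"
  shows "(1 - e) * chord K x + e * chord L x' \<le> chord (mix e K L) ((1 - e) * x + e * x')"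
proof -
  let ?z = "(1 - e) * x + e * x'"
  have N: "compact (mix e K L)"
    by (intro compact_mix assms)
  have "mix e {y. pt x y \<in> K} {y. pt x' y \<in> L} \<subseteq> {y. pt ?z y \<in> mix e K L}"
  proof
    fix w assume "w \<in> mix e {y. pt x y \<in> K} {y. pt x' y \<in> L}"
    then obtain y y' where "pt x y \<in> K" "pt x' y' \<in> L" "w = (1 - e) *\<^sub>R y + e *\<^sub>R y'"
      by (auto elim: mixE)
    then show "w \<in> {y. pt ?z y \<in> mix e K L}"
      using mixI[of "pt x y" K "pt x' y'" L e] by (simp add: pt_linear_combination)
  qed
  then have "ennreal (1 - e) * emeasure lborel {y. pt x y \<in> K} + ennreal e * emeasure lborel {y. pt x' y \<in> L}
      \<le> emeasure lborel {y. pt ?z y \<in> mix e K L}"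
    using assms N by (intro emeasure_mix_real convex_slice bounded_slice slice_borel) auto
  moreover have "ennreal ((1 - e) * chord K x + e * chord L x')
      = ennreal (1 - e) * ennreal (chord K x) + ennreal e * ennreal (chord L x')"
    using e by (simp add: ennreal_mult)
  ultimately have "ennreal ((1 - e) * chord K x + e * chord L x') \<le> ennreal (chord (mix e K L) ?z)"
    by (simp only: emeasure_slice assms N)
  then show ?thesis
    by (subst (asm) ennreal_le_iff) auto
qed

text \<open>This is \<open>chord_mix\<close> for two slices of the same body, because
  \<open>mix v K K\<close> lies in \<open>K\<close>. As \<open>0 \<le> r\<close>, every point of the
  superlevel set has a nonempty slice.\<close>

lemma convex_chord_superlevel:
  assumes K: "compact K" "convex K" and r: "0 \<le> r"
  shows "convex {x. r < chord K x}"
proof (rule convexI)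
  fix x y u v :: real
  assume xy: "x \<in> {x. r < chord K x}" "y \<in> {x. r < chord K x}" and uv: "0 \<le> u" "0 \<le> v" "u + v = 1"
  show "u *\<^sub>R x + v *\<^sub>R y \<in> {x. r < chord K x}"
  proof (cases "0 < v \<and> v < 1")
    case True
    have N: "mix v K K \<subseteq> K"
      using K True by (intro mix_subset_convex) auto
    have "r < (1 - v) * chord K x + v * chord K y"
    proof -
      have "(1 - v) * r + v * r < (1 - v) * chord K x + v * chord K y"
        using xy True by (intro add_strict_mono mult_strict_left_mono) auto
      then show ?thesis by (simp add: algebra_simps)
    qed
    also have "\<dots> \<le> chord (mix v K K) ((1 - v) * x + v * y)"
      using True xy r K by (intro chord_mix slice_nonempty) auto
    also have "\<dots> \<le> chord K ((1 - v) * x + v * y)"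
    proof -
      have "ennreal (chord (mix v K K) ((1 - v) * x + v * y)) \<le> ennreal (chord K ((1 - v) * x + v * y))"
        using N K by (subst (1 2) emeasure_slice[symmetric])
          (auto intro!: emeasure_mono compact_mix simp: slice_borel)
      then show ?thesis by simp
    qed
    also have "(1 - v) * x + v * y = u *\<^sub>R x + v *\<^sub>R y"
      using uv(3) by (simp add: algebra_simps flip: uv(3))
    finally show ?thesis by simp
  next
    case False
    then have "v = 0 \<or> v = 1" using uv by auto
    then show ?thesis using uv xy by auto
  qed
qed

lemma chord_bounds:
  assumes "compact K"
  obtains r where "0 < r" "\<And>x. chord K x \<le> r" "\<And>x. 0 < chord K x \<Longrightarrow> \<bar>x\<bar> \<le> r"
proof -
  obtain r where r: "0 < r" "\<And>v. v \<in> K \<Longrightarrow> norm v \<le> r"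
    using compact_imp_bounded[OF assms] by (auto simp: bounded_pos)
  have *: "\<bar>x\<bar> \<le> r" "\<bar>y\<bar> \<le> r" if "pt x y \<in> K" for x y
    using r(2)[OF that] component_le_norm_cart[of "pt x y" 1] component_le_norm_cart[of "pt x y" 2] by auto
  have "chord K x \<le> 2 * r" for x
  proof -
    have "{y. pt x y \<in> K} \<subseteq> {-r..r}"
      using *(2) by (force simp: abs_le_iff)
    then have "emeasure lborel {y. pt x y \<in> K} \<le> emeasure lborel {-r..r}"
      by (intro emeasure_mono) auto
    then show ?thesis
      using r by (simp add: emeasure_slice[OF assms])
  qed
  moreover have "\<bar>x\<bar> \<le> 2 * r" if "0 < chord K x" for x
    using slice_nonempty[OF that] * r(1) by fastforce
  ultimately show ?thesis
    using that[of "2 * r"] r(1) by auto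
qed

section \<open>Maximal chords and the layer cake formula\<close>

definition max_chord :: "(real^2) set \<Rightarrow> real" where
  "max_chord K = (SUP x. chord K x)"

lemma bdd_above_chord: "compact K \<Longrightarrow> bdd_above (range (chord K))"
  by (rule chord_bounds[of K]) (auto intro!: bdd_aboveI)

lemma chord_le_max_chord: "compact K \<Longrightarrow> chord K x \<le> max_chord K"
  unfolding max_chord_def by (intro cSUP_upper bdd_above_chord) auto

lemma less_max_chordE:
  assumes "compact K" "r < max_chord K"
  obtains x where "r < chord K x"
  using assms bdd_above_chord[of K] by (auto simp: max_chord_def less_cSUP_iff)

lemma max_chord_pos:
  assumes "compact K" "0 < emeasure lborel K"
  shows "0 < max_chord K"
proof (rule ccontr)
  assume "\<not> 0 < max_chord K"
  then have "chord K x = 0" for x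
    using chord_le_max_chord[OF assms(1), of x] chord_nonneg[of K x] by linarith
  then show False
    using Fubini_compact(2)[OF assms(1)] assms(2) by simp
qed

text \<open>The area under the graph of \<open>chord K\<close> is computed by integrating over the
  levels, with the substitution of \<open>c * t\<close> for the level. The free factor
  \<open>c\<close> makes it possible to compare several bodies at the same relative level
  \<open>t\<close>.\<close>

lemma layer_cake:
  assumes K: "compact K" and c: "0 < c"
  shows "emeasure lborel K = ennreal c *
    (\<integral>\<^sup>+t. indicator {0<..} t * emeasure lborel {x. t * c < chord K x} \<partial>lborel)"
proof -
  have [measurable]: "chord K \<in> borel_measurable borel"
    using K by (rule Fubini_compact)
  define g where "g y = (\<integral>\<^sup>+x. indicator {(x, y). 0 < y \<and> y < chord K x} (x, y) \<partial>lborel)" for y :: real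
  have set_m [measurable]: "{(x, y). 0 < y \<and> y < chord K x} \<in> sets (borel \<Otimes>\<^sub>M borel)"
  proof -
    have "{p \<in> space (borel \<Otimes>\<^sub>M borel). 0 < snd p \<and> snd p < chord K (fst p)} \<in> sets (borel \<Otimes>\<^sub>M borel)"
      by measurable
    then show ?thesis
      by (simp add: space_pair_measure case_prod_unfold)
  qed
  have g_m [measurable]: "g \<in> borel_measurable borel"
    unfolding g_def [abs_def] by measurable
  have "emeasure lborel K = (\<integral>\<^sup>+x. ennreal (chord K x) \<partial>lborel)"
    using K by (rule Fubini_compact)
  also have "\<dots> = (\<integral>\<^sup>+x. \<integral>\<^sup>+y. indicator {(x, y). 0 < y \<and> y < chord K x} (x, y) \<partial>lborel \<partial>lborel)"
  proof (intro nn_integral_cong)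
    fix x
    have "(\<integral>\<^sup>+y. indicator {(x, y). 0 < y \<and> y < chord K x} (x, y) \<partial>lborel)
        = (\<integral>\<^sup>+y. indicator {0<..<chord K x} y \<partial>lborel)"
      by (intro nn_integral_cong) (auto simp: indicator_def)
    then show "ennreal (chord K x) = (\<integral>\<^sup>+y. indicator {(x, y). 0 < y \<and> y < chord K x} (x, y) \<partial>lborel)"
      by simp
  qed
  also have "\<dots> = (\<integral>\<^sup>+y. g y \<partial>lborel)"
    unfolding g_def by (rule lborel_pair.Fubini'[symmetric]) simp
  also have "\<dots> = ennreal c * (\<integral>\<^sup>+t. g (0 + c * t) \<partial>lborel)"
    using c by (subst nn_integral_real_affine[OF g_m, of c 0]) auto
  also have "(\<integral>\<^sup>+t. g (0 + c * t) \<partial>lborel)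
      = (\<integral>\<^sup>+t. indicator {0<..} t * emeasure lborel {x. t * c < chord K x} \<partial>lborel)"
  proof (intro nn_integral_cong)
    fix t :: real
    show "g (0 + c * t) = indicator {0<..} t * emeasure lborel {x. t * c < chord K x}"
    proof (cases "0 < t")
      case True
      then have "g (0 + c * t) = (\<integral>\<^sup>+x. indicator {x. t * c < chord K x} x \<partial>lborel)"
        unfolding g_def using c by (intro nn_integral_cong) (auto simp: indicator_def mult.commute)
      then show ?thesis using True by simp
    next
      case False
      then have "\<not> 0 < c * t" using c by (simp add: zero_less_mult_iff)
      then show ?thesis using False by (simp add: g_def)
    qed
  qed
  finally show ?thesis .
qed

text \<open>From relative level \<open>1\<close> on, the superlevel sets are empty. Below it they
  are nonempty, as the one-dimensional inequality requires.\<close>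

lemma layer_cake_max_chord:
  assumes K: "compact K" and m: "0 < max_chord K"
  shows "emeasure lborel K = ennreal (max_chord K) *
    (\<integral>\<^sup>+t. indicator {0<..<1} t * emeasure lborel {x. t * max_chord K < chord K x} \<partial>lborel)"
proof -
  let ?a = "max_chord K"
  have "{x. t * ?a < chord K x} = {}" if "1 \<le> t" for t
  proof -
    have "1 * ?a \<le> t * ?a" using m that by (intro mult_right_mono) auto
    then have "\<not> t * ?a < chord K x" for x
      using chord_le_max_chord[OF K, of x] by linarith
    then show ?thesis by simp
  qed
  then have "indicator {0<..} t * emeasure lborel {x. t * ?a < chord K x}
      = indicator {0<..<1} t * emeasure lborel {x. t * ?a < chord K x}" for t
    by (cases "t < 1") (auto simp: indicator_def)
  then show ?thesis
    using layer_cake[OF assms] by simp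
qed

text \<open>Rescaling the levels by the maximal chords matches the superlevel sets of the chord
  length functions of \<open>K\<close> and \<open>L\<close>; these are intervals, so the one-dimensional inequality
  applies level by level.\<close>

lemma measure_mix_ge_max_chord:
  assumes K: "compact K" "convex K" and L: "compact L" "convex L"
    and A: "measure lborel K = A" "measure lborel L = A" "0 < A" and e: "0 < e" "e < 1"
  shows "A + A * e * (1 - e) * (max_chord K - max_chord L)\<^sup>2 / (max_chord K * max_chord L)
    \<le> measure lborel (mix e K L)"
proof -
  define a where "a = max_chord K"
  define b where "b = max_chord L"
  define N where "N = mix e K L"
  \<comment> \<open>The level scale for \<open>N\<close> is the combination of the two maximal
    chords, so that relative level \<open>t\<close> of \<open>K\<close> and \<open>L\<close> is
    carried into relative level \<open>t\<close> of \<open>N\<close>. It is not claimed to be the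
    maximal chord of \<open>N\<close>; levels of \<open>N\<close> with \<open>t \<ge> 1\<close> are
    simply dropped in \<open>cN\<close>.\<close>
  define c where "c = (1 - e) * a + e * b"
  have N: "compact N" unfolding N_def by (intro compact_mix K L)
  have fin: "emeasure lborel S = ennreal (measure lborel S)" if "compact S" for S :: "(real^2) set"
    using emeasure_compact_finite[OF that] by (intro emeasure_eq_ennreal_measure) (auto simp: less_top)
  have ab: "0 < a" "0 < b"
    unfolding a_def b_def using K L A fin by (auto intro!: max_chord_pos)
  then have c: "0 < c" using e by (simp add: c_def add_pos_pos)
  note [measurable] = Fubini_compact(1)[OF K(1)] Fubini_compact(1)[OF L(1)] Fubini_compact(1)[OF N]
  define qK where "qK t = indicator {0<..<1} t * emeasure lborel {x. t * a < chord K x}" for t :: real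
  define qL where "qL t = indicator {0<..<1} t * emeasure lborel {x. t * b < chord L x}" for t :: real
  define qN where "qN t = indicator {0<..<1} t * emeasure lborel {x. t * c < chord N x}" for t :: real
  have meas: "(\<lambda>t. emeasure lborel {x. t * r < chord S x}) \<in> borel_measurable borel"
    if [measurable]: "chord S \<in> borel_measurable borel" for S and r :: real
  proof -
    have "{(t, x). t * r < chord S x} \<in> sets (borel \<Otimes>\<^sub>M lborel)"
    proof -
      have "{p \<in> space (borel \<Otimes>\<^sub>M borel). fst p * r < chord S (snd p)} \<in> sets (borel \<Otimes>\<^sub>M borel)"
        by measurable
      then show ?thesis
        by (simp add: space_pair_measure case_prod_unfold)
    qed
    from lborel.measurable_emeasure_Pair[OF this] show ?thesis
      by (simp add: vimage_def)
  qed
  have [measurable]: "qK \<in> borel_measurable borel" "qL \<in> borel_measurable borel" "qN \<in> borel_measurable borel"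
    unfolding qK_def [abs_def] qL_def [abs_def] qN_def [abs_def]
    by (intro borel_measurable_times_ennreal meas borel_measurable_indicator; measurable)+
  have eK: "ennreal A = ennreal a * (\<integral>\<^sup>+t. qK t \<partial>lborel)"
    using layer_cake_max_chord[OF K(1)] ab fin[OF K(1)] A unfolding a_def qK_def by simp
  have eL: "ennreal A = ennreal b * (\<integral>\<^sup>+t. qL t \<partial>lborel)"
    using layer_cake_max_chord[OF L(1)] ab fin[OF L(1)] A unfolding b_def qL_def by simp
  have chN: "(1 - e) * chord K x + e * chord L y \<le> chord N ((1 - e) * x + e * y)"
    if "0 < chord K x" "0 < chord L y" for x y
    unfolding N_def using that K L e by (intro chord_mix slice_nonempty)
  have le: "ennreal (1 - e) * qK t + ennreal e * qL t \<le> qN t" for t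
  proof (cases "0 < t \<and> t < 1")
    case True
    have "t * a < max_chord K" "t * b < max_chord L"
      using True ab by (simp_all add: a_def b_def)
    then have ne: "\<exists>x. t * a < chord K x" "\<exists>x. t * b < chord L x"
      using less_max_chordE[OF K(1)] less_max_chordE[OF L(1)] by metis+
    have bd: "bounded {x. r < chord S x}" if S: "compact S" and "0 < r" for r S
    proof -
      obtain r' where "\<And>x. 0 < chord S x \<Longrightarrow> \<bar>x\<bar> \<le> r'"
        using chord_bounds[OF S] by metis
      then show ?thesis
        using \<open>0 < r\<close> by (auto simp: bounded_iff intro!: exI[of _ r'])
    qed
    have "mix e {x. t * a < chord K x} {x. t * b < chord L x} \<subseteq> {x. t * c < chord N x}"
    proof
      fix z assume "z \<in> mix e {x. t * a < chord K x} {x. t * b < chord L x}"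
      then obtain x y where xy: "t * a < chord K x" "t * b < chord L y" "z = (1 - e) * x + e * y"
        by (auto elim: mixE)
      have "t * c = (1 - e) * (t * a) + e * (t * b)"
        by (simp add: c_def algebra_simps)
      also have "\<dots> < (1 - e) * chord K x + e * chord L y"
        using xy e by (intro add_strict_mono mult_strict_left_mono) auto
      also have "\<dots> \<le> chord N z"
        unfolding xy(3) using True ab xy by (intro chN) (auto intro: less_trans[rotated])
      finally show "z \<in> {x. t * c < chord N x}" by simp
    qed
    then have "ennreal (1 - e) * emeasure lborel {x. t * a < chord K x}
        + ennreal e * emeasure lborel {x. t * b < chord L x} \<le> emeasure lborel {x. t * c < chord N x}"
      using ne True ab K L e
      by (intro emeasure_mix_real convex_chord_superlevel bd) auto
    then show ?thesis
      using True by (simp add: qK_def qL_def qN_def)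
  qed (simp add: qK_def qL_def qN_def)
  have cN: "ennreal c * (\<integral>\<^sup>+t. qN t \<partial>lborel) \<le> emeasure lborel N"
    unfolding layer_cake[OF N c] qN_def
    by (intro mult_left_mono nn_integral_mono mult_right_mono) (auto simp: indicator_def)
  have "ennreal c * (ennreal (1 - e) * ennreal (A / a) + ennreal e * ennreal (A / b)) \<le> emeasure lborel N"
  proof -
    have div: "I = ennreal (A / r)" if "ennreal A = ennreal r * I" "0 < r" for I r
    proof -
      have "ennreal A = ennreal r * ennreal (A / r)"
        using that A(3) by (simp flip: ennreal_mult)
      then show ?thesis
        using that by (simp add: ennreal_mult_cancel_left)
    qed
    have "(\<integral>\<^sup>+t. ennreal (1 - e) * qK t + ennreal e * qL t \<partial>lborel) \<le> (\<integral>\<^sup>+t. qN t \<partial>lborel)"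
      by (intro nn_integral_mono le)
    then have "ennreal (1 - e) * ennreal (A / a) + ennreal e * ennreal (A / b) \<le> (\<integral>\<^sup>+t. qN t \<partial>lborel)"
      using div[OF eK] div[OF eL] ab by (simp add: nn_integral_add nn_integral_cmult)
    then show ?thesis
      by (intro order_trans[OF mult_left_mono cN]) auto
  qed
  moreover have "ennreal c * (ennreal (1 - e) * ennreal P + ennreal e * ennreal Q)
      = ennreal (c * ((1 - e) * P + e * Q))" if "0 \<le> P" "0 \<le> Q" for P Q
    using that e c by (simp add: ennreal_mult)
  ultimately have "ennreal (c * ((1 - e) * (A / a) + e * (A / b))) \<le> ennreal (measure lborel N)"
    using ab A(3) fin[OF N] by (simp del: ennreal_le_iff)
  then have "c * ((1 - e) * (A / a) + e * (A / b)) \<le> measure lborel N"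
    by (subst (asm) ennreal_le_iff) auto
  \<comment> \<open>The product of the combination of \<open>a\<close> and \<open>b\<close> with
    that of \<open>1 / a\<close> and \<open>1 / b\<close> exceeds \<open>1\<close> by a multiple of
    \<open>(a - b)\<close> squared. This surplus will force the maximal chords to agree.\<close>
  moreover have "c * ((1 - e) * (A / a) + e * (A / b)) = A + A * e * (1 - e) * (a - b)\<^sup>2 / (a * b)"
    using ab by (simp add: c_def field_simps power2_eq_square)
  ultimately show ?thesis
    by (simp add: a_def b_def N_def)
qed

section \<open>Bodies with equality in Brunn-Minkowski\<close>

lemma emeasure_compact_eq_measure:
  "compact S \<Longrightarrow> emeasure lborel S = ennreal (measure lborel (S :: 'a::euclidean_space set))"
  using emeasure_compact_finite[of S] by (intro emeasure_eq_ennreal_measure) (auto simp: less_top)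

lemma fmeasurable_compact: "compact S \<Longrightarrow> S \<in> fmeasurable lborel" for S :: "'a::euclidean_space set"
  using emeasure_compact_finite[of S] by (auto simp: fmeasurable_def borel_compact less_top)

lemma hyperplane_null_sets_lborel:
  fixes a :: "'a::euclidean_space"
  assumes "a \<noteq> 0" shows "{x. a \<bullet> x = b} \<in> null_sets lborel"
proof -
  have "{x. a \<bullet> x = b} \<in> null_sets lebesgue"
    using assms negligible_hyperplane negligible_iff_null_sets by blast
  moreover have "{x. a \<bullet> x = b} \<in> sets lborel"
    by (simp add: closed_hyperplane borel_closed)
  ultimately show ?thesis
    using null_sets_completion_iff by blast
qed

text \<open>For bodies of equal area, this expresses the equality case of the Brunn-Minkowski inequality in
  differential form.\<close>

definition mix_stationary :: "(real^2) set \<Rightarrow> (real^2) set \<Rightarrow> bool" where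
  "mix_stationary K L \<longleftrightarrow> compact K \<and> convex K \<and> compact L \<and> convex L \<and>
     0 < measure lborel K \<and> measure lborel L = measure lborel K \<and>
     (\<exists>C. \<forall>e. 0 < e \<and> e < 1 \<longrightarrow> measure lborel (mix e K L) \<le> measure lborel K + C * e\<^sup>2)"

text \<open>The Brunn-Minkowski inequality for equal areas, obtained by dropping the nonnegative
  surplus.\<close>

lemma measure_mix_ge:
  fixes K L :: "(real^2) set"
  assumes "compact K" "convex K" "compact L" "convex L"
    and "measure lborel L = measure lborel K" "0 < measure lborel K" "0 < e" "e < 1"
  shows "measure lborel K \<le> measure lborel (mix e K L)"
proof -
  have "0 < max_chord K" "0 < max_chord L"
    using assms by (auto intro!: max_chord_pos simp: emeasure_compact_eq_measure)
  then have "0 \<le> measure lborel K * e * (1 - e) * (max_chord K - max_chord L)\<^sup>2 / (max_chord K * max_chord L)"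
    using assms by simp
  then show ?thesis
    using measure_mix_ge_max_chord[OF assms(1-4) refl assms(5-8)] by linarith
qed

text \<open>Both sides converge as \<open>e\<close> tends to \<open>0\<close> from the right. It
  expresses that a gain of first order in \<open>e\<close> cannot stay below a bound of second
  order; it is applied after division by \<open>e\<close>.\<close>

lemma first_order_nonpos:
  fixes D C :: real
  assumes "\<And>e. 0 < e \<Longrightarrow> e < 1 \<Longrightarrow> (1 - e) * D \<le> C * e"
  shows "D \<le> 0"
proof (rule tendsto_le[of "at_right (0::real)"])
  show "((\<lambda>e. (1 - e) * D) \<longlongrightarrow> D) (at_right 0)"
    by (rule tendsto_eq_intros refl | simp)+
  show "((\<lambda>e. C * e) \<longlongrightarrow> 0) (at_right 0)"
    by (rule tendsto_eq_intros refl | simp)+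
  show "\<forall>\<^sub>F e in at_right 0. (1 - e) * D \<le> C * e"
    unfolding eventually_at_right_field by (intro exI[of _ 1]) (auto intro: assms)
qed simp

text \<open>The surplus in \<open>measure_mix_ge_max_chord\<close> is of first order in
  \<open>e\<close>, while stationarity allows an excess of second order only, so its coefficient
  \<open>D\<close> vanishes.\<close>

lemma mix_stationary_max_chord:
  assumes "mix_stationary K L" shows "max_chord K = max_chord L"
proof -
  obtain C where K: "compact K" "convex K" and L: "compact L" "convex L"
    and A: "0 < measure lborel K" "measure lborel L = measure lborel K"
    and C: "\<And>e. 0 < e \<Longrightarrow> e < 1 \<Longrightarrow> measure lborel (mix e K L) \<le> measure lborel K + C * e\<^sup>2"
    using assms unfolding mix_stationary_def by blast
  define D where "D = measure lborel K * (max_chord K - max_chord L)\<^sup>2 / (max_chord K * max_chord L)"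
  have pos: "0 < max_chord K" "0 < max_chord L"
    using K L A by (auto intro!: max_chord_pos simp: emeasure_compact_eq_measure)
  have D: "(1 - e) * D \<le> C * e" if "0 < e" "e < 1" for e
  proof -
    have "measure lborel K + e * ((1 - e) * D) \<le> measure lborel K + C * e\<^sup>2"
      using measure_mix_ge_max_chord[OF K L refl A(2,1) that] C[OF that]
      by (simp add: D_def mult_ac)
    then have "e * ((1 - e) * D) \<le> e * (C * e)"
      by (simp add: power2_eq_square mult_ac)
    then show ?thesis using that by simp
  qed
  have "D \<le> 0"
    using D by (rule first_order_nonpos)
  moreover have "0 < D" if "max_chord K \<noteq> max_chord L"
    unfolding D_def using that pos A by simp
  ultimately show ?thesis by fastforce
qed

section \<open>Rotations, and equality of the sets of difference vectors\<close>

lemma measure_lborel_orthogonal_image: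
  fixes g :: "real^2 \<Rightarrow> real^2"
  assumes "orthogonal_transformation g" "compact S"
  shows "measure lborel (g ` S) = measure lborel S"
proof -
  have "compact (g ` S)"
    using assms by (intro compact_continuous_image linear_continuous_on)
      (auto simp: orthogonal_transformation_linear linear_linear)
  moreover have "measure lebesgue (g ` S) = measure lebesgue S"
    using assms by (intro measure_orthogonal_image lmeasurable_compact)
  ultimately show ?thesis
    using assms by (simp add: borel_compact)
qed

lemma mix_stationary_orthogonal_image:
  assumes "mix_stationary K L" and g: "orthogonal_transformation g"
  shows "mix_stationary (g ` K) (g ` L)"
proof -
  have lin: "linear g" using g by (rule orthogonal_transformation_linear)
  have "continuous_on S g" for S
    using lin by (simp add: linear_continuous_on linear_linear)
  then have "compact (g ` S)" if "compact S" for S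
    using that by (rule compact_continuous_image)
  then show ?thesis
    using assms lin unfolding mix_stationary_def
    by (auto simp: measure_lborel_orthogonal_image mix_linear_image compact_mix convex_linear_image)
qed

lemma chord_ge_segment:
  assumes K: "compact K" "convex K" and p: "p \<in> K" "p + pt 0 r \<in> K" and r: "0 \<le> r"
  shows "r \<le> chord K (p $ 1)"
proof -
  let ?S = "{y. pt (p $ 1) y \<in> K}"
  have "pt (p $ 1) (p $ 2 + r) = p + pt 0 r"
    by (simp add: vec_eq_iff forall_2)
  then have S: "p $ 2 \<in> ?S" "p $ 2 + r \<in> ?S"
    using p by (simp_all only: pt_eta mem_Collect_eq)
  have iv: "is_interval ?S"
    using convex_slice[OF K(2)] by (simp only: is_interval_convex_1)
  have "{p $ 2..p $ 2 + r} \<subseteq> ?S"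
    using mem_is_interval_1_I[OF iv S] by (meson atLeastAtMost_iff subsetI)
  then have "emeasure lborel {p $ 2..p $ 2 + r} \<le> emeasure lborel ?S"
    using slice_borel[OF K(1)] by (intro emeasure_mono) simp_all
  then show ?thesis
    using r by (simp add: emeasure_slice[OF K(1)])
qed

lemma chord_segmentE:
  assumes "compact K" "convex K" "0 \<le> r" "r < chord K x"
  obtains p where "p \<in> K" "p + pt 0 r \<in> K"
proof -
  let ?S = "{y. pt x y \<in> K}"
  have S: "compact ?S" "?S \<noteq> {}"
    using assms compact_slice slice_nonempty[of K x] by auto
  obtain l where l: "l \<in> ?S" "\<And>y. y \<in> ?S \<Longrightarrow> l \<le> y"
    using compact_attains_inf[OF S] by blast
  obtain h where h: "h \<in> ?S" "\<And>y. y \<in> ?S \<Longrightarrow> y \<le> h"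
    using compact_attains_sup[OF S] by blast
  have "emeasure lborel ?S \<le> emeasure lborel {l..h}"
    using l h by (intro emeasure_mono) auto
  moreover have "l \<le> h" using l(2) h(1) .
  ultimately have "chord K x \<le> h - l"
    by (simp add: emeasure_slice[OF assms(1)])
  then have "l \<le> l + r" "l + r \<le> h"
    using assms(3,4) by linarith+
  moreover have "is_interval ?S"
    using convex_slice[OF assms(2)] by (simp only: is_interval_convex_1)
  ultimately have "l + r \<in> ?S"
    using mem_is_interval_1_I[OF _ l(1) h(1)] by blast
  moreover have "pt x l + pt 0 r = pt x (l + r)"
    using pt_linear_combination[of 1 x l 1 0 r] by simp
  ultimately show ?thesis
    using l(1) that[of "pt x l"] by simp
qed

text \<open>A vertical chord of length \<open>r\<close> in \<open>K\<close> bounds the common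
  maximal chord from below. In \<open>L\<close> this provides chords of every length below
  \<open>r\<close>, and compactness of the set of differences provides length \<open>r\<close>
  itself.\<close>

lemma max_chord_eq_difference:
  assumes K: "compact K" "convex K" and L: "compact L" "convex L"
    and eq: "max_chord K = max_chord L" and p: "p \<in> K" "p + pt 0 r \<in> K" and r: "0 \<le> r"
    and ne: "L \<noteq> {}"
  shows "\<exists>q\<in>L. q + pt 0 r \<in> L"
proof (cases "r = 0")
  case True
  then show ?thesis
    using ne by (auto simp: pt_def)
next
  case False
  let ?D = "{x - y | x y. x \<in> L \<and> y \<in> L}"
  have cl: "compact ?D"
    by (intro compact_differences L)
  have "r \<le> max_chord L"
    using chord_ge_segment[OF K p r] chord_le_max_chord[OF K(1), of "p $ 1"] eq by simp
  have "pt 0 r \<in> closure ?D"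
    unfolding closure_approachable
  proof (intro allI impI)
    fix d :: real assume d: "0 < d"
    \<comment> \<open>Strictly below \<open>max_chord L\<close>, so that some slice is longer than
      \<open>s\<close>; within \<open>d\<close> of \<open>r\<close>; and cut off at \<open>0\<close>
      to remain a length.\<close>
    define s where "s = max 0 (r - d / 2)"
    have s: "0 \<le> s" "s < max_chord L" "\<bar>s - r\<bar> < d"
      using d False \<open>r \<le> max_chord L\<close> r by (auto simp: s_def)
    obtain x where "s < chord L x"
      using less_max_chordE[OF L(1) s(2)] .
    from chord_segmentE[OF L s(1) this] obtain q where q: "q \<in> L" "q + pt 0 s \<in> L" .
    moreover have "dist (pt 0 s) (pt 0 r) = \<bar>s - r\<bar>"
    proof -
      have "pt 0 s - pt 0 r = pt 0 (s - r)"
        using pt_linear_combination[of 1 0 s "-1" 0 r] by simp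
      then show ?thesis
        by (simp add: dist_norm) (simp add: pt_def)
    qed
    ultimately show "\<exists>y\<in>?D. dist y (pt 0 r) < d"
      using s(3) \<open>q \<in> L\<close> \<open>q + pt 0 s \<in> L\<close>
      by (intro bexI[of _ "pt 0 s"]) (simp, intro CollectI exI[of _ "q + pt 0 s"] exI[of _ q], simp)
  qed
  then have "pt 0 r \<in> ?D"
    using cl by (simp add: compact_imp_closed)
  then obtain x y where "pt 0 r = x - y" "x \<in> L" "y \<in> L"
    by blast
  then show ?thesis
    by (intro bexI[of _ y]) simp_all
qed

text \<open>A rotation makes \<open>x - y\<close> vertical. It preserves stationarity, so the
  rotated bodies have equal maximal chords, and a chord found in one of them is rotated back. Thus
  \<open>K\<close> and \<open>L\<close> have the same difference body.\<close>

lemma mix_stationary_difference: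
  assumes st: "mix_stationary K L"
  shows "x \<in> K \<Longrightarrow> y \<in> K \<Longrightarrow> \<exists>x'\<in>L. \<exists>y'\<in>L. x' - y' = x - y"
    and "x \<in> L \<Longrightarrow> y \<in> L \<Longrightarrow> \<exists>x'\<in>K. \<exists>y'\<in>K. x' - y' = x - y"
proof -
  obtain g :: "real^2 \<Rightarrow> real^2" where g: "orthogonal_transformation g" "g (x - y) = pt 0 (norm (x - y))"
    using orthogonal_transformation_exists[of "x - y" "pt 0 (norm (x - y))"] by (auto simp: pt_def)
  have lin: "linear g" using g(1) by (rule orthogonal_transformation_linear)
  have inj: "inj g" using g(1) by (rule orthogonal_transformation_inj)
  have gxy: "g y + pt 0 (norm (x - y)) = g x"
    using linear_diff[OF lin, of x y] g(2) by (simp add: algebra_simps)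
  have st': "mix_stationary (g ` K) (g ` L)"
    by (rule mix_stationary_orthogonal_image[OF st g(1)])
  then have cc: "compact (g ` K)" "convex (g ` K)" "compact (g ` L)" "convex (g ` L)"
    by (auto simp: mix_stationary_def)
  have ne: "K \<noteq> {}" "L \<noteq> {}"
    using st by (auto simp: mix_stationary_def)
  have eq: "max_chord (g ` K) = max_chord (g ` L)"
    by (rule mix_stationary_max_chord[OF st'])
  have pull: "\<exists>x'\<in>S. \<exists>y'\<in>S. x' - y' = x - y" if q: "\<exists>q\<in>g ` S. q + pt 0 (norm (x - y)) \<in> g ` S" for S
  proof -
    obtain x' y' where "x' \<in> S" "y' \<in> S" "g y' + pt 0 (norm (x - y)) = g x'"
      using q by force
    moreover from this(3)[symmetric] have "g (x' - y') = g (x - y)"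
      unfolding linear_diff[OF lin, of x' y'] g(2) by simp
    ultimately show ?thesis
      using injD[OF inj] by blast
  qed
  show "\<exists>x'\<in>L. \<exists>y'\<in>L. x' - y' = x - y" if "x \<in> K" "y \<in> K"
  proof (rule pull, rule max_chord_eq_difference[OF cc eq, where p = "g y"])
    show "g y \<in> g ` K" using that(2) by (rule imageI)
    show "g y + pt 0 (norm (x - y)) \<in> g ` K" unfolding gxy using that(1) by (rule imageI)
    show "g ` L \<noteq> {}" using ne by blast
  qed (rule norm_ge_zero)
  show "\<exists>x'\<in>K. \<exists>y'\<in>K. x' - y' = x - y" if "x \<in> L" "y \<in> L"
  proof (rule pull, rule max_chord_eq_difference[OF cc(3,4,1,2) eq[symmetric], where p = "g y"])
    show "g y \<in> g ` L" using that(2) by (rule imageI)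
    show "g y + pt 0 (norm (x - y)) \<in> g ` L" unfolding gxy using that(1) by (rule imageI)
    show "g ` K \<noteq> {}" using ne by blast
  qed (rule norm_ge_zero)
qed

section \<open>Cuts by parallel lines, and widths\<close>

lemma measure_Un_separated:
  fixes X Y :: "'a::euclidean_space set"
  assumes "compact X" "compact Y" "u \<noteq> 0" "\<And>x. x \<in> X \<Longrightarrow> u \<bullet> x \<le> b" "\<And>y. y \<in> Y \<Longrightarrow> b \<le> u \<bullet> y"
  shows "measure lborel (X \<union> Y) = measure lborel X + measure lborel Y"
proof (rule measure_Un_AE)
  have "AE x in lborel. x \<notin> {x. u \<bullet> x = b}"
    using hyperplane_null_sets_lborel[OF assms(3)] by (rule AE_not_in)
  then show "AE x in lborel. x \<notin> X \<or> x \<notin> Y"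
    by eventually_elim (use assms(4,5) in \<open>force intro: antisym\<close>)
qed (simp_all add: fmeasurable_compact assms)

lemma compact_halfspace_le: "compact K \<Longrightarrow> compact (K \<inter> {x. u \<bullet> x \<le> b})"
  and compact_halfspace_ge: "compact K \<Longrightarrow> compact (K \<inter> {x. u \<bullet> x \<ge> b})"
  by (simp_all add: compact_Int_closed closed_halfspace_le closed_halfspace_ge)

lemma convex_Int_halfspace_le: "convex K \<Longrightarrow> convex (K \<inter> {x. u \<bullet> x \<le> b})"
  and convex_Int_halfspace_ge: "convex K \<Longrightarrow> convex (K \<inter> {x. u \<bullet> x \<ge> b})"
  by (simp_all add: convex_Int convex_halfspace_le convex_halfspace_ge)

lemma measure_halfspace_split:
  fixes K :: "'a::euclidean_space set"
  assumes "compact K" "u \<noteq> 0"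
  shows "measure lborel K = measure lborel (K \<inter> {x. u \<bullet> x \<le> b}) + measure lborel (K \<inter> {x. u \<bullet> x \<ge> b})"
proof -
  have "K = (K \<inter> {x. u \<bullet> x \<le> b}) \<union> (K \<inter> {x. u \<bullet> x \<ge> b})" by auto
  moreover have "measure lborel ((K \<inter> {x. u \<bullet> x \<le> b}) \<union> (K \<inter> {x. u \<bullet> x \<ge> b}))
      = measure lborel (K \<inter> {x. u \<bullet> x \<le> b}) + measure lborel (K \<inter> {x. u \<bullet> x \<ge> b})"
    using compact_halfspace_le[OF assms(1)] compact_halfspace_ge[OF assms(1)] assms(2)
    by (rule measure_Un_separated[where b = b]) auto
  ultimately show ?thesis by simp
qed

text \<open>The excess of \<open>measure lborel (mix e K L)\<close> over the common area is superadditive under cuts,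
  and it is nonnegative on the remaining piece.\<close>

lemma mix_stationary_cut:
  assumes st: "mix_stationary K L" and u: "u \<noteq> 0"
    and m: "measure lborel (K \<inter> {x. u \<bullet> x \<le> a}) = m" "measure lborel (L \<inter> {x. u \<bullet> x \<le> b}) = m"
      "0 < m" "m < measure lborel K"
  shows "mix_stationary (K \<inter> {x. u \<bullet> x \<le> a}) (L \<inter> {x. u \<bullet> x \<le> b})"
proof -
  let ?K1 = "K \<inter> {x. u \<bullet> x \<le> a}" and ?K2 = "K \<inter> {x. u \<bullet> x \<ge> a}"
  let ?L1 = "L \<inter> {x. u \<bullet> x \<le> b}" and ?L2 = "L \<inter> {x. u \<bullet> x \<ge> b}"
  obtain C where K: "compact K" "convex K" and L: "compact L" "convex L"
    and A: "0 < measure lborel K" "measure lborel L = measure lborel K"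
    and C: "\<And>e. 0 < e \<Longrightarrow> e < 1 \<Longrightarrow> measure lborel (mix e K L) \<le> measure lborel K + C * e\<^sup>2"
    using st unfolding mix_stationary_def by blast
  note cc = compact_halfspace_le[OF K(1)] compact_halfspace_ge[OF K(1)]
    compact_halfspace_le[OF L(1)] compact_halfspace_ge[OF L(1)]
    convex_Int_halfspace_le[OF K(2)] convex_Int_halfspace_ge[OF K(2)]
    convex_Int_halfspace_le[OF L(2)] convex_Int_halfspace_ge[OF L(2)]
  have m2: "measure lborel ?K2 = measure lborel K - m" "measure lborel ?L2 = measure lborel K - m"
    using measure_halfspace_split[OF K(1) u, of a] measure_halfspace_split[OF L(1) u, of b] m A by auto
  have "measure lborel (mix e ?K1 ?L1) \<le> m + C * e\<^sup>2" if e: "0 < e" "e < 1" for e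
  proof -
    \<comment> \<open>The two combined pieces lie on opposite sides of the line at the combined
      level of the cuts.\<close>
    have "measure lborel (mix e ?K1 ?L1) + measure lborel (mix e ?K2 ?L2)
        = measure lborel (mix e ?K1 ?L1 \<union> mix e ?K2 ?L2)"
    proof (rule measure_Un_separated[symmetric, OF _ _ u, where b = "(1 - e) * a + e * b"])
      show "u \<bullet> x \<le> (1 - e) * a + e * b" if "x \<in> mix e ?K1 ?L1" for x
        using that e by (auto elim!: mixE simp: inner_add_right intro!: add_mono mult_left_mono)
      show "(1 - e) * a + e * b \<le> u \<bullet> x" if "x \<in> mix e ?K2 ?L2" for x
        using that e by (auto elim!: mixE simp: inner_add_right intro!: add_mono mult_left_mono)
    qed (intro compact_mix cc)+
    also have "\<dots> \<le> measure lborel (mix e K L)"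
    proof (rule measure_mono_fmeasurable)
      show "mix e ?K1 ?L1 \<union> mix e ?K2 ?L2 \<subseteq> mix e K L"
        by (intro Un_least mix_mono) auto
      show "mix e ?K1 ?L1 \<union> mix e ?K2 ?L2 \<in> sets lborel"
        unfolding sets_lborel by (intro borel_compact compact_Un compact_mix cc)
    qed (intro fmeasurable_compact compact_mix K L)
    also have "\<dots> \<le> measure lborel K + C * e\<^sup>2"
      by (rule C[OF e])
    finally have "measure lborel (mix e ?K1 ?L1) + measure lborel (mix e ?K2 ?L2) \<le> measure lborel K + C * e\<^sup>2" .
    moreover have "measure lborel ?K2 \<le> measure lborel (mix e ?K2 ?L2)"
      using cc m m2 e by (intro measure_mix_ge) auto
    ultimately show ?thesis
      using m2 by linarith
  qed
  then show ?thesis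
    unfolding mix_stationary_def using cc m by auto
qed

text \<open>The usual support function at \<open>u\<close> is
  \<open>- lower_support (- u) K\<close>. Hence
  \<open>lower_support u K + lower_support (- u) K\<close> is minus the length of the range of
  \<open>u \<bullet> x\<close> over \<open>K\<close>, that is, minus the width for unit vectors
  \<open>u\<close>.\<close>

definition lower_support :: "'a::real_inner \<Rightarrow> 'a set \<Rightarrow> real" where
  "lower_support u K = (INF x\<in>K. u \<bullet> x)"

lemma lower_support_attained:
  assumes "compact K" "K \<noteq> {}"
  obtains x where "x \<in> K" "u \<bullet> x = lower_support u K" "\<And>y. y \<in> K \<Longrightarrow> lower_support u K \<le> u \<bullet> y"
proof -
  have "continuous_on K (\<lambda>x. u \<bullet> x)" by (intro continuous_intros)
  from continuous_attains_inf[OF assms this]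
  obtain x where x: "x \<in> K" "\<And>y. y \<in> K \<Longrightarrow> u \<bullet> x \<le> u \<bullet> y" by blast
  then have "lower_support u K = u \<bullet> x"
    unfolding lower_support_def by (intro cInf_eq_minimum) auto
  with x show ?thesis by (intro that[of x]) auto
qed

lemma lower_support_le:
  assumes "compact K" "y \<in> K" shows "lower_support u K \<le> u \<bullet> y"
  using lower_support_attained[OF assms(1)] assms(2) by (metis empty_iff)

text \<open>The width is the largest value of \<open>u\<close> on difference vectors, up to sign,
  and both bodies have the same difference vectors. The inequality \<open>*\<close> is proved for
  arbitrary bodies in order to be used in both directions.\<close>

lemma mix_stationary_width:
  assumes st: "mix_stationary K L"
  shows "lower_support u K + lower_support (- u) K = lower_support u L + lower_support (- u) L"
proof -
  have *: "lower_support u L + lower_support (- u) L \<le> lower_support u K + lower_support (- u) K"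
    if cp: "compact K" "compact L" "K \<noteq> {}" and d: "\<And>x y. x \<in> K \<Longrightarrow> y \<in> K \<Longrightarrow> \<exists>x'\<in>L. \<exists>y'\<in>L. x' - y' = x - y"
    for K L :: "(real^2) set"
  proof -
    obtain x where x: "x \<in> K" "u \<bullet> x = lower_support u K"
      using lower_support_attained cp(1,3) by metis
    obtain y where y: "y \<in> K" "- u \<bullet> y = lower_support (- u) K"
      using lower_support_attained cp(1,3) by metis
    obtain x' y' where xy: "x' \<in> L" "y' \<in> L" "x' - y' = x - y"
      using d[OF x(1) y(1)] by blast
    have "lower_support u L + lower_support (- u) L \<le> u \<bullet> x' + - u \<bullet> y'"
      using xy \<open>compact L\<close> by (intro add_mono lower_support_le)
    also have "\<dots> = u \<bullet> (x' - y')" by (simp add: inner_diff_right)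
    also have "\<dots> = u \<bullet> x + - u \<bullet> y" unfolding xy(3) by (simp add: inner_diff_right)
    finally show ?thesis using x y by simp
  qed
  have cp: "compact K" "compact L" "K \<noteq> {}" "L \<noteq> {}"
    using st by (auto simp: mix_stationary_def)
  show ?thesis
    using *[OF cp(1-3) mix_stationary_difference(1)[OF st]]
      *[OF cp(2,1,4) mix_stationary_difference(2)[OF st]] by (rule antisym[rotated])
qed

section \<open>Marginals of a body in a given direction\<close>

definition marginal :: "'a::euclidean_space \<Rightarrow> 'a set \<Rightarrow> real measure" where
  "marginal u K = distr (density lborel (indicator K)) borel ((\<bullet>) u)"

lemma sets_marginal [simp]: "sets (marginal u K) = sets borel"
  by (simp add: marginal_def)

lemma emeasure_marginal:
  assumes "compact K" "S \<in> sets borel"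
  shows "emeasure (marginal u K) S = emeasure lborel (K \<inter> {x. u \<bullet> x \<in> S})"
proof -
  have "(\<bullet>) u -` S \<in> sets lborel"
    using measurable_sets[of "(\<bullet>) u" borel borel S] assms(2) by simp
  then show ?thesis
    using assms unfolding marginal_def
    by (subst emeasure_distr) (auto simp: emeasure_restricted borel_compact vimage_def)
qed

lemma finite_borel_measure_marginal:
  assumes "compact K"
  shows "finite_borel_measure (marginal u K)"
proof -
  have "emeasure (marginal u K) (space (marginal u K)) = emeasure lborel K"
    using emeasure_marginal[OF assms, of UNIV u] by (simp add: marginal_def)
  then have "finite_measure (marginal u K)"
    using emeasure_compact_finite[OF assms] by (intro finite_measureI) (auto simp: less_top)
  then show ?thesis
    unfolding finite_borel_measure_def finite_borel_measure_axioms_def by simp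
qed

text \<open>Links areas of pieces cut off by a line to distribution functions, for which continuity
  criteria and uniqueness results are at hand.\<close>

lemma cdf_marginal:
  assumes "compact K"
  shows "cdf (marginal u K) t = measure lborel (K \<inter> {x. u \<bullet> x \<le> t})"
  using emeasure_marginal[OF assms, of "{..t}" u] by (simp add: cdf_def measure_def)

text \<open>A jump would be the area of a part of a line.\<close>

lemma isCont_cdf_marginal:
  assumes "compact K" "u \<noteq> 0"
  shows "isCont (cdf (marginal u K)) t"
proof -
  interpret finite_borel_measure "marginal u K"
    using assms(1) by (rule finite_borel_measure_marginal)
  have "K \<inter> {x. u \<bullet> x \<in> {t}} \<subseteq> {x. u \<bullet> x = t}" by auto
  then have "emeasure lborel (K \<inter> {x. u \<bullet> x \<in> {t}}) = 0"
    using hyperplane_null_sets_lborel[OF assms(2), of t] by (metis emeasure_eq_0 null_setsD1 null_setsD2)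
  then show ?thesis
    using emeasure_marginal[OF assms(1), of "{t}" u] by (simp add: isCont_cdf measure_def)
qed

lemma cdf_marginal_bounds:
  assumes "compact K"
  shows "0 \<le> cdf (marginal u K) t" "cdf (marginal u K) t \<le> measure lborel K"
    "\<exists>t. cdf (marginal u K) t = measure lborel K" "\<exists>t. cdf (marginal u K) t = 0"
proof -
  show "0 \<le> cdf (marginal u K) t"
    by (simp add: cdf_def)
  show "cdf (marginal u K) t \<le> measure lborel K"
    unfolding cdf_marginal[OF assms]
    by (intro measure_mono_fmeasurable fmeasurableD fmeasurable_compact compact_halfspace_le assms) auto
  show "\<exists>t. cdf (marginal u K) t = measure lborel K"
  proof -
    have "K \<inter> {x. u \<bullet> x \<le> - lower_support (- u) K} = K"
      using lower_support_le[OF assms, of _ "- u"] by force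
    then show ?thesis using cdf_marginal[OF assms] by metis
  qed
  show "\<exists>t. cdf (marginal u K) t = 0"
  proof -
    have "K \<inter> {x. u \<bullet> x \<le> lower_support u K - 1} = {}"
      using lower_support_le[OF assms, of _ u] by fastforce
    then show ?thesis using cdf_marginal[OF assms] by (metis measure_empty)
  qed
qed

lemma cdf_marginal_IVT:
  assumes "compact K" "u \<noteq> 0" "0 \<le> m" "m \<le> measure lborel K"
  obtains t where "cdf (marginal u K) t = m"
proof -
  let ?F = "cdf (marginal u K)"
  obtain s s' where s: "?F s = 0" "?F s' = measure lborel K"
    using cdf_marginal_bounds[OF assms(1)] by metis
  interpret finite_borel_measure "marginal u K"
    using assms(1) by (rule finite_borel_measure_marginal)
  show ?thesis
  proof (cases "s \<le> s'")
    case True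
    then show ?thesis
      using IVT[of ?F s m s'] s assms isCont_cdf_marginal that by auto
  next
    \<comment> \<open>A zero to the right of a point where the maximum is taken forces area
      \<open>0\<close>, hence \<open>m = 0\<close>, and \<open>s\<close> itself is the
      witness.\<close>
    case False
    then have "measure lborel K \<le> 0"
      using cdf_nondecreasing[of s' s] s by auto
    then show ?thesis using s assms that[of s] by auto
  qed
qed

text \<open>The area conditions put points of \<open>K\<close> on both sides of the line, so the
  lowest point survives the cut, and by connectedness \<open>K\<close> meets the line. The piece
  therefore extends from \<open>lower_support u K\<close> to \<open>a\<close>.\<close>

lemma lower_support_cut:
  assumes K: "compact K" "convex K" and m: "0 < measure lborel (K \<inter> {x. u \<bullet> x \<le> a})"
     "measure lborel (K \<inter> {x. u \<bullet> x \<le> a}) < measure lborel K"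
  shows "lower_support u (K \<inter> {x. u \<bullet> x \<le> a}) = lower_support u K" "lower_support (- u) (K \<inter> {x. u \<bullet> x \<le> a}) = - a"
proof -
  let ?K1 = "K \<inter> {x. u \<bullet> x \<le> a}"
  have c1: "compact ?K1" using K by (intro compact_halfspace_le)
  have ne: "?K1 \<noteq> {}" "?K1 \<noteq> K" using m by (auto simp del: Int_Collect)
  obtain y where y: "y \<in> K" "u \<bullet> y = lower_support u K"
    using lower_support_attained[OF K(1)] ne by (metis Int_empty_left)
  obtain p q where pq: "p \<in> K" "u \<bullet> p \<le> a" "q \<in> K" "a \<le> u \<bullet> q" using ne by force
  obtain z where z: "z \<in> K" "u \<bullet> z = a"
    using connected_ivt_hyperplane[OF convex_connected[OF K(2)] pq(1,3,2,4)] by blast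
  have y1: "y \<in> ?K1" using y pq lower_support_le[OF K(1) pq(1), of u] by simp
  obtain w where w: "w \<in> ?K1" "u \<bullet> w = lower_support u ?K1" using lower_support_attained[OF c1 ne(1)] by metis
  show "lower_support u ?K1 = lower_support u K"
    using lower_support_le[OF c1 y1, of u] lower_support_le[OF K(1), of w u] w y by auto
  obtain v where v: "v \<in> ?K1" "- u \<bullet> v = lower_support (- u) ?K1" using lower_support_attained[OF c1 ne(1)] by metis
  show "lower_support (- u) ?K1 = - a"
    using lower_support_le[OF c1, of z "- u"] v z by auto
qed

text \<open>Cutting \<open>K\<close> and \<open>L\<close> by parallel lines into pieces of equal areas preserves stationarity, so the
  pieces have equal widths.\<close>

lemma mix_stationary_cdf:
  assumes st: "mix_stationary K L" and u: "u \<noteq> 0"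
  shows "cdf (marginal u K) (lower_support u K + t) = cdf (marginal u L) (lower_support u L + t)"
proof -
  let ?A = "measure lborel K"
  define F where "F t = cdf (marginal u K) (lower_support u K + t)" for t
  define G where "G t = cdf (marginal u L) (lower_support u L + t)" for t
  have K: "compact K" "convex K" and L: "compact L" "convex L"
    and A: "0 < ?A" "measure lborel L = ?A"
    using st unfolding mix_stationary_def by blast+
  interpret K: finite_borel_measure "marginal u K"
    using K(1) by (rule finite_borel_measure_marginal)
  interpret L: finite_borel_measure "marginal u L"
    using L(1) by (rule finite_borel_measure_marginal)
  \<comment> \<open>The two pieces have equal areas, hence equal widths; these are \<open>s\<close>
    and \<open>t\<close>, since arguments are measured from the lowest points of \<open>K\<close>
    and \<open>L\<close>.\<close>
  have match: "s = t" if "F s = G t" "0 < F s" "F s < ?A" for s t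
  proof -
    let ?K1 = "K \<inter> {x. u \<bullet> x \<le> lower_support u K + s}" and ?L1 = "L \<inter> {x. u \<bullet> x \<le> lower_support u L + t}"
    have eq: "measure lborel ?K1 = F s" "measure lborel ?L1 = F s"
      using that(1) cdf_marginal[OF K(1)] cdf_marginal[OF L(1)] by (simp_all add: F_def G_def)
    have "mix_stationary ?K1 ?L1"
      using eq that by (intro mix_stationary_cut[OF st u]) auto
    from mix_stationary_width[OF this, of u] show ?thesis
      using lower_support_cut[OF K, of u "lower_support u K + s"] lower_support_cut[OF L, of u "lower_support u L + t"] eq that A by simp
  qed
  have mono: "F s \<le> F t" "G s \<le> G t" if "s \<le> t" for s t
    unfolding F_def G_def using that by (auto intro!: K.cdf_nondecreasing L.cdf_nondecreasing)
  have surj: "\<exists>t. F t = m" "\<exists>t. G t = m" if "0 \<le> m" "m \<le> ?A" for m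
  proof -
    show "\<exists>t. F t = m"
      using cdf_marginal_IVT[OF K(1) u that] unfolding F_def by (metis add.commute diff_add_cancel)
    show "\<exists>t. G t = m"
      using cdf_marginal_IVT[OF L(1) u that(1)] that(2) A unfolding G_def by (metis add.commute diff_add_cancel)
  qed
  have bd: "0 \<le> F t" "F t \<le> ?A" "0 \<le> G t" "G t \<le> ?A" for t
    using cdf_marginal_bounds[OF K(1)] cdf_marginal_bounds[OF L(1)] A by (auto simp: F_def G_def)
  have "F t = G t"
  proof (rule ccontr)
    assume ne: "F t \<noteq> G t"
    \<comment> \<open>The midpoint lies strictly between \<open>0\<close> and the full area, where
      \<open>match\<close> applies. Both functions take it at the same argument, and monotonicity
      then contradicts that it separates their values at \<open>t\<close>.\<close>
    define m where "m = (F t + G t) / 2"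
    have m: "0 < m" "m < ?A" "F t < m \<and> m < G t \<or> G t < m \<and> m < F t"
      using ne bd[of t] by (auto simp: m_def)
    obtain s s' where "F s = m" "G s' = m" using surj m by (meson less_imp_le)
    moreover from this have "s = s'" using match m by simp
    ultimately show False
      using m(3) mono[of s t] mono[of t s] by (cases "s \<le> t") auto
  qed
  then show ?thesis by (simp add: F_def G_def)
qed

lemma integral_marginal:
  assumes K: "compact K" and f: "continuous_on UNIV f"
  shows "(LINT t|marginal u K. f t) = (LINT x:K|lborel. (f (u \<bullet> x) :: real))"
proof -
  have [measurable]: "f \<in> borel_measurable borel" "K \<in> sets borel"
    using f K by (simp_all add: borel_measurable_continuous_onI borel_compact)
  have "(LINT t|marginal u K. f t) = (LINT x|density lborel (\<lambda>x. ennreal (indicator K x)). f (u \<bullet> x))"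
    unfolding marginal_def by (subst integral_distr) (auto simp: ennreal_indicator)
  also have "\<dots> = (LINT x:K|lborel. f (u \<bullet> x))"
    unfolding set_lebesgue_integral_def by (subst integral_density) auto
  finally show ?thesis .
qed

text \<open>The distribution functions agree up to the shift and the total masses are equal, so the
  tails agree; finite tails determine a Borel measure on the line.\<close>

lemma mix_stationary_marginal:
  assumes st: "mix_stationary K L" and u: "u \<noteq> 0"
  shows "marginal u K = distr (marginal u L) borel (\<lambda>t. t + (lower_support u K - lower_support u L))"
proof -
  define c where "c = lower_support u K - lower_support u L"
  have K: "compact K" and L: "compact L" and A: "measure lborel L = measure lborel K"
    using st unfolding mix_stationary_def by blast+
  have tail: "emeasure (marginal u S) {x<..} = ennreal (measure lborel S - cdf (marginal u S) x)"
    if S: "compact S" for S :: "(real^2) set" and x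
  proof -
    interpret finite_borel_measure "marginal u S"
      using S by (rule finite_borel_measure_marginal)
    have sp: "space (marginal u S) = UNIV"
      by (simp add: marginal_def)
    have "measure (marginal u S) UNIV = measure lborel S"
      using emeasure_marginal[OF S, of UNIV u] by (simp add: measure_def)
    moreover have "UNIV - {..x} = {x<..}" by auto
    ultimately have "measure (marginal u S) {x<..} = measure lborel S - cdf (marginal u S) x"
      using finite_measure_compl[of "{..x}"] by (simp add: sp cdf_def)
    then show ?thesis
      by (simp add: emeasure_eq_measure)
  qed
  have "marginal u K = distr (marginal u L) borel (\<lambda>t. t + c)"
  proof (rule measure_eqI_lessThan)
    fix x
    show "emeasure (marginal u K) {x<..} < \<infinity>"
      by (simp add: tail[OF K])
    have "(\<lambda>t. t + c) -` {x<..} = {x - c<..}" by auto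
    then have "emeasure (distr (marginal u L) borel (\<lambda>t. t + c)) {x<..} = emeasure (marginal u L) {x - c<..}"
      by (subst emeasure_distr) (auto simp: marginal_def)
    then show "emeasure (marginal u K) {x<..} = emeasure (distr (marginal u L) borel (\<lambda>t. t + c)) {x<..}"
      using mix_stationary_cdf[OF st u, of "x - lower_support u K"] A
      by (simp add: tail[OF K] tail[OF L] c_def algebra_simps)
  qed simp_all
  then show ?thesis by (simp add: c_def)
qed

lemma integrable_compact_continuous:
  fixes f :: "'a::euclidean_space \<Rightarrow> 'b::{banach, second_countable_topology}"
  assumes "compact K" "continuous_on K f"
  shows "set_integrable lborel K f"
  using borel_integrable_compact[OF assms] by (simp add: set_integrable_def)

text \<open>Both bodies have the same marginals up to a shift \<open>c(u)\<close>; comparing first moments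
  shows that \<open>c(u)\<close> is linear in \<open>u\<close>.\<close>

lemma mix_stationary_lower_support:
  assumes st: "mix_stationary K L"
  shows "lower_support u K = lower_support u L + u \<bullet> ((1 / measure lborel K) *\<^sub>R ((LINT x:K|lborel. x) - (LINT x:L|lborel. x)))"
proof (cases "u = 0")
  case True
  have "K \<noteq> {}" "L \<noteq> {}" using st by (auto simp: mix_stationary_def)
  then show ?thesis using True by (simp add: lower_support_def)
next
  case False
  define c where "c = lower_support u K - lower_support u L"
  have K: "compact K" and L: "compact L" and A: "measure lborel L = measure lborel K" "0 < measure lborel K"
    using st unfolding mix_stationary_def by blast+
  have moment: "(LINT x:S|lborel. u \<bullet> x) = u \<bullet> (LINT x:S|lborel. x)" if "compact S" for S
    using integrable_compact_continuous[OF that continuous_on_id]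
    by (simp add: set_lebesgue_integral_def set_integrable_def flip: integral_inner_right)
  have "u \<bullet> (LINT x:K|lborel. x) = (LINT t|marginal u K. t)"
    using integral_marginal[OF K continuous_on_id] moment[OF K] by simp
  also have "\<dots> = (LINT t|marginal u L. t + c)"
    unfolding mix_stationary_marginal[OF st False] c_def[symmetric]
    by (subst integral_distr) (auto simp: marginal_def)
  also have "\<dots> = (LINT x:L|lborel. u \<bullet> x + c)"
    by (rule integral_marginal[OF L]) (intro continuous_intros)
  also have "\<dots> = (LINT x:L|lborel. u \<bullet> x) + (LINT x:L|lborel. c)"
    by (intro set_integral_add integrable_compact_continuous L continuous_intros)
  also have "(LINT x:L|lborel. c) = measure lborel L * c"
    using L by (subst set_integral_const) (auto simp: borel_compact emeasure_compact_eq_measure)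
  \<comment> \<open>After division by the area, the shift is the inner product of \<open>u\<close>
    with the difference of the centroids.\<close>
  finally have "c * measure lborel K = u \<bullet> ((LINT x:K|lborel. x) - (LINT x:L|lborel. x))"
    using moment[OF L] A by (simp add: inner_diff_right algebra_simps)
  then have "c = (1 / measure lborel K) * (u \<bullet> ((LINT x:K|lborel. x) - (LINT x:L|lborel. x)))"
    using A(2) by (simp add: eq_divide_eq)
  then show ?thesis
    unfolding inner_scaleR_right by (simp add: c_def)
qed

text \<open>If \<open>x - w\<close> were outside \<open>L\<close>, the normal \<open>a\<close> of a
  separating line would violate the relation between the support values.\<close>

lemma subset_translate_if_lower_support_eq:
  fixes K L :: "'a::euclidean_space set"
  assumes K: "compact K" and L: "compact L" "convex L" "L \<noteq> {}"
    and lower_support: "\<And>u. lower_support u K = lower_support u L + u \<bullet> w" and x: "x \<in> K"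
  shows "x - w \<in> L"
proof (rule ccontr)
  assume "x - w \<notin> L"
  then obtain a b where ab: "a \<bullet> (x - w) < b" "\<And>y. y \<in> L \<Longrightarrow> b < a \<bullet> y"
    using separating_hyperplane_closed_point[of L "x - w"] L by (metis compact_imp_closed)
  obtain y where "y \<in> L" "a \<bullet> y = lower_support a L"
    using lower_support_attained L by metis
  then show False
    using ab lower_support_le[OF K x, of a] lower_support[of a] by (force simp: inner_diff_right)
qed

text \<open>Compact convex sets are determined by their support functions, and adding a linear
  function to the support function is a translation. The two inclusions use \<open>v\<close> and
  \<open>- v\<close>.\<close>

lemma mix_stationary_translate:
  assumes st: "mix_stationary K L"
  shows "\<exists>w. L = (\<lambda>x. x + w) ` K"
proof -
  define v where "v = (1 / measure lborel K) *\<^sub>R ((LINT x:K|lborel. x) - (LINT x:L|lborel. x))"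
  have lower_support: "lower_support u K = lower_support u L + u \<bullet> v" for u
    unfolding v_def by (rule mix_stationary_lower_support[OF st])
  then have lower_support': "lower_support u L = lower_support u K + u \<bullet> (- v)" for u
    by simp
  have K: "compact K" "convex K" "K \<noteq> {}" and L: "compact L" "convex L" "L \<noteq> {}"
    using st unfolding mix_stationary_def by auto
  have "L = (\<lambda>x. x + - v) ` K"
    using subset_translate_if_lower_support_eq[OF K(1) L lower_support] subset_translate_if_lower_support_eq[OF L(1) K lower_support']
    by (force simp: image_iff)
  then show ?thesis by blast
qed

section \<open>Corresponding edges of tilings\<close>

text \<open>The rotation by a quarter turn. It writes \<open>cross2 z\<close> as an inner product,
  so that facts on half-spaces and hyperplanes apply to the side of a directed line.\<close>

definition perp :: "real^2 \<Rightarrow> real^2" where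
  "perp z = vector [- z $ 2, z $ 1]"

lemma inner_perp: "perp z \<bullet> x = cross2 z x"
  by (simp add: perp_def cross2_def inner_vec_def sum_2)

lemma perp_eq_0_iff [simp]: "perp z = 0 \<longleftrightarrow> z = 0"
  by (auto simp: perp_def vec_eq_iff forall_2)

lemma perp_surj: "\<exists>z. perp z = a"
proof
  show "perp (vector [a $ 2, - a $ 1]) = a"
    by (simp add: perp_def vec_eq_iff forall_2)
qed

lemma cross2_simps:
  "cross2 z (x + y) = cross2 z x + cross2 z y"
  "cross2 z (x - y) = cross2 z x - cross2 z y"
  "cross2 z (c *\<^sub>R x) = c * cross2 z x"
  "cross2 (c *\<^sub>R z) x = c * cross2 z x"
  "cross2 (- z) x = - cross2 z x"
  "cross2 z z = 0"
  by (simp_all add: cross2_def algebra_simps)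

lemma cross2_eq_0_parallel:
  assumes "cross2 z x = 0" "z \<noteq> 0"
  obtains c where "x = c *\<^sub>R z"
proof -
  have eq: "z $ 1 * x $ 2 = z $ 2 * x $ 1" using assms(1) by (simp add: cross2_def)
  show ?thesis
  proof (cases "z $ 1 = 0")
    case True
    then have "z $ 2 \<noteq> 0" using assms(2) by (auto simp: vec_eq_iff forall_2)
    with True eq have "x = (x $ 2 / z $ 2) *\<^sub>R z"
      by (auto simp: vec_eq_iff forall_2)
    then show ?thesis by (rule that)
  next
    case False
    with eq have "x = (x $ 1 / z $ 1) *\<^sub>R z"
      by (auto simp: vec_eq_iff forall_2 field_simps)
    then show ?thesis by (rule that)
  qed
qed

lemma inner_constant_on_segment:
  fixes n :: "'a::real_inner"
  assumes "p \<in> closed_segment c d" "q \<in> closed_segment c d" "p \<noteq> q" "n \<bullet> p = b" "n \<bullet> q = b"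
    and "x \<in> closed_segment c d"
  shows "n \<bullet> x = b"
proof -
  obtain s where s: "p = c + s *\<^sub>R (d - c)"
    using assms(1) by (auto simp: in_segment algebra_simps)
  obtain t where t: "q = c + t *\<^sub>R (d - c)"
    using assms(2) by (auto simp: in_segment algebra_simps)
  obtain r where r: "x = c + r *\<^sub>R (d - c)"
    using assms(6) by (auto simp: in_segment algebra_simps)
  have "s * (n \<bullet> (d - c)) = t * (n \<bullet> (d - c))"
  proof -
    have "n \<bullet> c + s * (n \<bullet> (d - c)) = b" "n \<bullet> c + t * (n \<bullet> (d - c)) = b"
      using assms(4,5) s t by (simp_all add: inner_add_right)
    then show ?thesis by linarith
  qed
  moreover have "s \<noteq> t" using s t assms(3) by auto
  ultimately have "n \<bullet> (d - c) = 0" by simp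
  then show ?thesis
    using assms(4) s r by (simp add: inner_add_right)
qed

lemma collinear_hyperplane_Int:
  fixes n :: "real^2"
  assumes "n \<noteq> 0" "S \<subseteq> {x. n \<bullet> x = b}"
  shows "collinear S"
  using aff_dim_subset[OF assms(2)] aff_dim_hyperplane[OF assms(1), of b]
  by (simp add: collinear_aff_dim)

text \<open>The maximal segment is the component of \<open>p\<close> in the part of the skeleton on
  the given line: being compact, connected and collinear, it is a segment. \<open>X\<close> is a
  connected set rather than a segment because it will be the union of two overlapping edges.\<close>

lemma maximal_segment_exists:
  assumes "compact (skeleton T)" "X \<subseteq> skeleton T" "connected X"
    and n: "n \<noteq> 0" "X \<subseteq> {x. n \<bullet> x = b}" and pq: "p \<in> X" "q \<in> X" "p \<noteq> q"
  obtains s where "s \<in> maximal_segments T" "X \<subseteq> s"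
proof -
  let ?S = "skeleton T \<inter> {x. n \<bullet> x = b}"
  define C where "C = connected_component_set ?S p"
  have S: "compact ?S"
    using assms(1) closed_hyperplane by (rule compact_Int_closed)
  have CS: "C \<subseteq> ?S"
    unfolding C_def by (rule connected_component_subset)
  have XC: "X \<subseteq> C"
    unfolding C_def using assms by (intro connected_component_maximal) auto
  have "compact C"
  proof -
    have "closed C"
      unfolding C_def using S by (intro closed_connected_component compact_imp_closed)
    with S have "compact (?S \<inter> C)"
      by (rule compact_Int_closed)
    then show ?thesis using CS by (simp add: Int_absorb1)
  qed
  moreover have "connected C"
    unfolding C_def by (rule connected_connected_component)
  moreover have "collinear C"
    using CS by (intro collinear_hyperplane_Int[OF n(1), of _ b]) auto
  moreover have "C \<noteq> {}" using XC pq by auto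
  ultimately obtain a d where ad: "C = closed_segment a d"
    using compact_convex_collinear_segment_alt by metis
  have pqC: "p \<in> C" "q \<in> C" "n \<bullet> p = b" "n \<bullet> q = b"
    using XC pq n(2) by blast+
  then have "a \<noteq> d" using pq(3) ad by auto
  moreover have "closed_segment c e = C"
    if ce: "C \<subseteq> closed_segment c e" "closed_segment c e \<subseteq> skeleton T" for c e
  proof (rule antisym)
    \<comment> \<open>A larger segment shares the distinct points \<open>p\<close> and
      \<open>q\<close> with the line, so it stays on the line and inside the component.\<close>
    have in_line: "closed_segment c e \<subseteq> {x. n \<bullet> x = b}"
      using inner_constant_on_segment[of p c e q n b] ce(1) pqC pq(3) by blast
    show "closed_segment c e \<subseteq> C"
      unfolding C_def using ce in_line XC pq by (intro connected_component_maximal) auto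
  qed (rule ce)
  ultimately have "C \<in> maximal_segments T"
    using ad CS unfolding maximal_segments_def by blast
  then show ?thesis using XC that by blast
qed

section \<open>Edges of convex polygons and separation of tiles\<close>

lemma convex_polygonD:
  assumes "convex_polygon t"
  shows "compact t" "convex t" "polytope t" "interior t \<noteq> {}" "t \<noteq> {}"
  using assms unfolding convex_polygon_def
  by (auto simp: polytope_imp_compact polytope_imp_convex)

text \<open>A supporting line that contains two points of the polygon cuts out an edge. Since the
  polygon is on the left of \<open>z\<close>, traversing the edge in the direction of
  \<open>z\<close> is counterclockwise.\<close>

lemma convex_polygon_supporting_edge:
  assumes t: "convex_polygon t" and z: "z \<noteq> 0" and le: "\<And>x. x \<in> t \<Longrightarrow> b \<le> cross2 z x"
    and pq: "p \<in> t" "q \<in> t" "p \<noteq> q" "cross2 z p = b" "cross2 z q = b"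
  obtains c where "0 < c" "ccw_edge_vector t (t \<inter> {x. cross2 z x = b}) (c *\<^sub>R z)"
proof -
  let ?e = "t \<inter> {x. cross2 z x = b}"
  have e: "?e = t \<inter> {x. perp z \<bullet> x = b}" by (simp add: inner_perp)
  note t = convex_polygonD[OF t]
  have face: "?e face_of t"
    unfolding e by (rule face_of_Int_supporting_hyperplane_ge[OF t(2)]) (simp add: inner_perp le)
  have "aff_dim ?e \<le> 1"
    using aff_dim_subset[of ?e "{x. perp z \<bullet> x = b}"] aff_dim_hyperplane[of "perp z" b] z
    by (simp add: inner_perp)
  moreover have "aff_dim {p, q} \<le> aff_dim ?e"
    using pq by (intro aff_dim_subset) auto
  ultimately have "?e edge_of t"
    using face pq(3) by (simp add: edge_of_def)
  have "compact ?e" "convex ?e"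
    unfolding e using t by (auto intro!: compact_Int_closed closed_hyperplane convex_Int convex_hyperplane)
  moreover have "collinear ?e" using z by (intro collinear_hyperplane_Int[of "perp z" _ b]) (auto simp: inner_perp)
  moreover have "?e \<noteq> {}" using pq by auto
  ultimately obtain a d where ad: "?e = closed_segment a d"
    using compact_convex_collinear_segment by metis
  have "p \<in> closed_segment a d" "q \<in> closed_segment a d"
    unfolding ad[symmetric] using pq by auto
  then have in_e: "a \<in> ?e" "d \<in> ?e" "a \<noteq> d"
    unfolding ad using pq(3) by auto
  then have "cross2 z (d - a) = 0" by (simp add: cross2_simps)
  then obtain c where c: "d - a = c *\<^sub>R z"
    using z cross2_eq_0_parallel by blast
  have "c \<noteq> 0" using c in_e by auto
  have side: "0 \<le> cross2 (k *\<^sub>R z) (x - y)" if "0 < k" "x \<in> t" "y \<in> ?e" for k x y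
    using that le[of x] by (simp add: cross2_simps)
  \<comment> \<open>The end points \<open>a\<close> and \<open>d\<close> come in no particular
    order; the sign of \<open>c\<close> tells which of them is the start of the edge.\<close>
  show ?thesis
  proof (cases "0 < c")
    case True
    have "ccw_edge_vector t ?e (c *\<^sub>R z)"
      unfolding ccw_edge_vector_def using \<open>?e edge_of t\<close> side[OF True] in_e ad c
      by (metis add.commute diff_add_cancel)
    then show ?thesis using True that by blast
  next
    case False
    then have k: "0 < - c" using \<open>c \<noteq> 0\<close> by simp
    have "?e = closed_segment d (d + (- c) *\<^sub>R z)"
      unfolding ad using c by (simp add: closed_segment_commute flip: c)
    then have "ccw_edge_vector t ?e ((- c) *\<^sub>R z)"
      unfolding ccw_edge_vector_def using \<open>?e edge_of t\<close> side[OF k] in_e by blast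
    then show ?thesis using k that by blast
  qed
qed

text \<open>Faces of polytopes are exposed, so the edge lies on a supporting line. Its outer normal
  \<open>a\<close> is converted into a direction \<open>z\<close> with the polygon on the
  left.\<close>

lemma ccw_edge_vector_exists:
  assumes t: "convex_polygon t" and e: "e edge_of t"
  shows "\<exists>z. ccw_edge_vector t e z"
proof -
  note t' = convex_polygonD[OF t]
  have face: "e face_of t" "aff_dim e = 1" using e by (auto simp: edge_of_def)
  then have "e exposed_face_of t"
    using exposed_face_of_polyhedron[OF polytope_imp_polyhedron[OF t'(3)]] by blast
  then obtain a b where ab: "t \<subseteq> {x. a \<bullet> x \<le> b}" "e = t \<inter> {x. a \<bullet> x = b}"
    by (auto simp: exposed_face_of_def)
  obtain p q where pq: "p \<in> e" "q \<in> e" "p \<noteq> q"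
  proof -
    have "e \<noteq> {}" using face(2) by auto
    then obtain p where "p \<in> e" by auto
    moreover have "e \<noteq> {p}" using face(2) by auto
    ultimately show ?thesis using that by blast
  qed
  have "a \<noteq> 0"
  proof
    assume "a = 0"
    then have "e = t" using ab pq by auto
    then have "aff_dim e = 2"
      using aff_dim_nonempty_interior[OF t'(4)] by simp
    then show False using face by simp
  qed
  obtain z where z: "perp z = - a" using perp_surj by blast
  have cr: "cross2 z x = - (a \<bullet> x)" for x
    using inner_perp[of z x] z by simp
  have "z \<noteq> 0" using z \<open>a \<noteq> 0\<close> perp_eq_0_iff[of z] by auto
  moreover have "- b \<le> cross2 z x" if "x \<in> t" for x using ab that by (auto simp: cr)
  moreover have "p \<in> t" "q \<in> t" "cross2 z p = - b" "cross2 z q = - b"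
    using ab pq by (auto simp: cr)
  ultimately obtain c where "ccw_edge_vector t (t \<inter> {x. cross2 z x = - b}) (c *\<^sub>R z)"
    using convex_polygon_supporting_edge[OF t] pq(3) by metis
  moreover have "t \<inter> {x. cross2 z x = - b} = e"
    using ab by (auto simp: cr)
  ultimately show ?thesis by auto
qed

lemma tilingD:
  assumes "tiling R T"
  shows "finite T" "t \<in> T \<Longrightarrow> convex_polygon t" "\<Union>T = R" "t \<in> T \<Longrightarrow> t \<subseteq> R"
    "s \<in> T \<Longrightarrow> t \<in> T \<Longrightarrow> s \<noteq> t \<Longrightarrow> interior s \<inter> interior t = {}"
  using assms by (auto simp: tiling_def pairwise_def)

lemma compact_skeleton: "tiling R T \<Longrightarrow> compact (skeleton T)"
  unfolding skeleton_def
  by (intro compact_UN compact_frontier) (auto dest: tilingD convex_polygonD)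

text \<open>The interiors are disjoint convex sets and can be separated; the inequalities pass to
  their closures, which are the bodies themselves.\<close>

lemma interior_disjoint_separated:
  fixes K H :: "'a::euclidean_space set"
  assumes "compact K" "convex K" "interior K \<noteq> {}" "compact H" "convex H" "interior H \<noteq> {}"
    and "interior K \<inter> interior H = {}"
  obtains a b where "a \<noteq> 0" "\<And>x. x \<in> K \<Longrightarrow> b \<le> a \<bullet> x" "\<And>x. x \<in> H \<Longrightarrow> a \<bullet> x \<le> b"
proof -
  obtain a b where ab: "a \<noteq> 0" "\<forall>x\<in>interior H. a \<bullet> x \<le> b" "\<forall>x\<in>interior K. a \<bullet> x \<ge> b"
    using separating_hyperplane_sets[of "interior H" "interior K"] assms
    by (metis convex_interior inf_commute)
  have cl: "closure (interior K) = K" "closure (interior H) = H"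
    using convex_closure_interior assms compact_imp_closed by (metis closure_closed)+
  have "closure (interior K) \<subseteq> {x. b \<le> a \<bullet> x}"
    using ab by (intro closure_minimal closed_halfspace_ge) auto
  moreover have "closure (interior H) \<subseteq> {x. a \<bullet> x \<le> b}"
    using ab by (intro closure_minimal closed_halfspace_le) auto
  ultimately show ?thesis
    using that[OF ab(1), of b] cl by auto
qed

text \<open>Tiles sharing a nontrivial segment lie on opposite sides of one maximal segment; this
  is visible in the associated graph and the edge vectors, so it carries over from
  one tiling to the other.\<close>

lemma tiles_opposite_sides_transfer:
  assumes T: "tiling R T"
    and T1: "tiling R T1" "combinatorial_equivalence R T T1 f1 g1" "same_orientations T f1 g1"
    and T2: "tiling R T2" "combinatorial_equivalence R T T2 f2 g2" "same_orientations T f2 g2"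
    and st: "s \<in> T" "t \<in> T" "s \<noteq> t"
    and pq: "p \<in> f1 s \<inter> f1 t" "q \<in> f1 s \<inter> f1 t" "p \<noteq> q"
  obtains u b1 b2 where "u \<noteq> 0" "\<And>x. x \<in> f1 s \<Longrightarrow> b1 \<le> u \<bullet> x" "\<And>x. x \<in> f1 t \<Longrightarrow> u \<bullet> x \<le> b1"
    "\<And>x. x \<in> f2 s \<Longrightarrow> b2 \<le> u \<bullet> x" "\<And>x. x \<in> f2 t \<Longrightarrow> u \<bullet> x \<le> b2"
proof -
  have bij1: "bij_betw f1 T T1" "bij_betw g1 (maximal_segments T) (maximal_segments T1)"
    and adj1: "\<And>t s. t \<in> T \<Longrightarrow> s \<in> maximal_segments T \<Longrightarrow> adjacent t s \<longleftrightarrow> adjacent (f1 t) (g1 s)"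
    using T1(2) by (auto simp: combinatorial_equivalence_def)
  have bij2: "bij_betw f2 T T2" "bij_betw g2 (maximal_segments T) (maximal_segments T2)"
    and adj2: "\<And>t s. t \<in> T \<Longrightarrow> s \<in> maximal_segments T \<Longrightarrow> adjacent t s \<longleftrightarrow> adjacent (f2 t) (g2 s)"
    using T2(2) by (auto simp: combinatorial_equivalence_def)
  have f1: "f1 s \<in> T1" "f1 t \<in> T1" "f1 s \<noteq> f1 t"
    using bij1(1) st by (auto simp: bij_betw_def inj_on_def)
  have f2: "f2 s \<in> T2" "f2 t \<in> T2"
    using bij2(1) st by (auto simp: bij_betw_def)
  have poly: "convex_polygon s" "convex_polygon t" "convex_polygon (f1 s)" "convex_polygon (f1 t)"
    "convex_polygon (f2 s)" "convex_polygon (f2 t)"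
    using tilingD(2) T T1(1) T2(1) st f1 f2 by blast+
  obtain a b where ab: "a \<noteq> 0" "\<And>x. x \<in> f1 s \<Longrightarrow> b \<le> a \<bullet> x" "\<And>x. x \<in> f1 t \<Longrightarrow> a \<bullet> x \<le> b"
    using interior_disjoint_separated[of "f1 s" "f1 t"] convex_polygonD[OF poly(3)]
      convex_polygonD[OF poly(4)] tilingD(5)[OF T1(1) f1] by metis
  \<comment> \<open>\<open>z\<close> directs the separating line so that \<open>f1 s\<close> is on
    its left; then \<open>f1 t\<close> is on the left of \<open>- z\<close>.\<close>
  obtain z where z: "perp z = a" using perp_surj by blast
  have cr: "cross2 z x = a \<bullet> x" for x using inner_perp[of z x] z by simp
  have "z \<noteq> 0" using z ab(1) perp_eq_0_iff[of z] by auto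
  have eq: "cross2 z p = b" "cross2 z q = b"
    using pq ab(2,3) by (auto simp: cr intro: antisym)
  let ?es = "f1 s \<inter> {x. cross2 z x = b}" and ?et = "f1 t \<inter> {x. cross2 z x = b}"
  obtain c where c: "0 < c" "ccw_edge_vector (f1 s) ?es (c *\<^sub>R z)"
    using convex_polygon_supporting_edge[OF poly(3) \<open>z \<noteq> 0\<close> _ _ _ pq(3) eq] ab(2) pq by (auto simp: cr)
  have "- b \<le> cross2 (- z) x" if "x \<in> f1 t" for x
    using ab(3)[OF that] by (simp add: cross2_simps cr)
  then obtain c' where c': "0 < c'" "ccw_edge_vector (f1 t) ?et (c' *\<^sub>R (- z))"
    using convex_polygon_supporting_edge[OF poly(4), of "- z" "- b" p q] pq eq \<open>z \<noteq> 0\<close>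
    by (auto simp: cross2_simps)
  have edges: "?es edge_of f1 s" "?et edge_of f1 t"
    using c(2) c'(2) by (auto simp: ccw_edge_vector_def)
  have edge_frontier: "e \<subseteq> frontier k" if "e edge_of k" "convex_polygon k" for e k :: "(real^2) set"
  proof -
    have "e \<noteq> k"
      using that aff_dim_nonempty_interior[OF convex_polygonD(4)[OF that(2)]]
      by (auto simp: edge_of_def)
    then have "e \<subseteq> rel_frontier k"
      using that(1) by (intro face_of_subset_rel_frontier) (auto simp: edge_of_def)
    then show ?thesis
      using rel_frontier_nonempty_interior[OF convex_polygonD(4)[OF that(2)]] by simp
  qed
  \<comment> \<open>The two edges share \<open>p\<close> and lie on one line, so their union fits
    into a single maximal segment.\<close>
  obtain s1 where s1: "s1 \<in> maximal_segments T1" "?es \<union> ?et \<subseteq> s1"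
  proof (rule maximal_segment_exists)
    show "compact (skeleton T1)" by (rule compact_skeleton[OF T1(1)])
    show "?es \<union> ?et \<subseteq> skeleton T1"
      using edge_frontier[OF edges(1) poly(3)] edge_frontier[OF edges(2) poly(4)] f1
      by (auto simp: skeleton_def)
    have "connected ?es" "connected ?et"
      using edges by (auto simp: edge_of_def intro!: convex_connected face_of_imp_convex)
    then show "connected (?es \<union> ?et)"
      using pq eq by (intro connected_Un) auto
    show "a \<noteq> 0" by (rule ab(1))
    show "?es \<union> ?et \<subseteq> {x. a \<bullet> x = b}" by (auto simp: cr)
    show "p \<in> ?es \<union> ?et" "q \<in> ?es \<union> ?et" "p \<noteq> q" using pq eq by auto
  qed auto
  obtain \<sigma> where \<sigma>: "\<sigma> \<in> maximal_segments T" "s1 = g1 \<sigma>"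
    using bij1(2) s1(1) by (auto simp: bij_betw_def)
  \<comment> \<open>Adjacency leads from the edge of \<open>f1 r\<close> in
    \<open>g1 \<sigma>\<close> to an edge of \<open>r\<close> in \<open>\<sigma>\<close>, and on to
    an edge of \<open>f2 r\<close> in \<open>g2 \<sigma>\<close>. Both edge vectors are positive
    multiples of the vector \<open>z0\<close> of the middle edge, hence of each other.\<close>
  have follow: "\<exists>k>0. \<exists>e. e \<subseteq> g2 \<sigma> \<and> ccw_edge_vector (f2 r) e (k *\<^sub>R v)"
    if r: "r \<in> T" "convex_polygon r" "convex_polygon (f2 r)" "e1 \<subseteq> s1" "ccw_edge_vector (f1 r) e1 v"
    for r e1 v
  proof -
    have "adjacent (f1 r) (g1 \<sigma>)"
      using r \<sigma>(2) by (auto simp: adjacent_def ccw_edge_vector_def)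
    then have adj: "adjacent r \<sigma>" using adj1[OF r(1) \<sigma>(1)] by simp
    then obtain e0 z0 where e0: "e0 \<subseteq> \<sigma>" "ccw_edge_vector r e0 z0"
      using ccw_edge_vector_exists[OF r(2)] unfolding adjacent_def by blast
    have "adjacent (f2 r) (g2 \<sigma>)" using adj adj2[OF r(1) \<sigma>(1)] by simp
    then obtain e2 z2 where e2: "e2 \<subseteq> g2 \<sigma>" "ccw_edge_vector (f2 r) e2 z2"
      using ccw_edge_vector_exists[OF r(3)] unfolding adjacent_def by blast
    have "corresponding_edge_vectors T f1 g1 r z0 v" "corresponding_edge_vectors T f2 g2 r z0 z2"
      unfolding corresponding_edge_vectors_def using e0 e2 r \<sigma> by blast+
    then obtain k1 k2 where "k1 > 0" "v = k1 *\<^sub>R z0" "k2 > 0" "z2 = k2 *\<^sub>R z0"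
      using T1(3) T2(3) r(1) unfolding same_orientations_def by metis
    then have "0 < k2 / k1" "z2 = (k2 / k1) *\<^sub>R v" by auto
    then show ?thesis using e2 by blast
  qed
  obtain k e where k: "0 < k" "e \<subseteq> g2 \<sigma>" "ccw_edge_vector (f2 s) e (k *\<^sub>R (c *\<^sub>R z))"
    using follow[OF st(1) poly(1,5) _ c(2)] s1(2) by auto
  obtain k' e' where k': "0 < k'" "e' \<subseteq> g2 \<sigma>" "ccw_edge_vector (f2 t) e' (k' *\<^sub>R (c' *\<^sub>R (- z)))"
    using follow[OF st(2) poly(2,6) _ c'(2)] s1(2) by auto
  obtain y where y: "e = closed_segment y (y + (k * c) *\<^sub>R z)" "\<And>x. x \<in> f2 s \<Longrightarrow> 0 \<le> cross2 ((k * c) *\<^sub>R z) (x - y)"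
    using k(3) by (auto simp: ccw_edge_vector_def)
  obtain y' where y': "e' = closed_segment y' (y' + (k' * c') *\<^sub>R (- z))"
    "\<And>x. x \<in> f2 t \<Longrightarrow> 0 \<le> cross2 ((k' * c') *\<^sub>R (- z)) (x - y')"
    using k'(3) by (auto simp: ccw_edge_vector_def)
  have "g2 \<sigma> \<in> maximal_segments T2" using bij2(2) \<sigma>(1) by (auto simp: bij_betw_def)
  then obtain h h' where h: "g2 \<sigma> = closed_segment h h'" by (auto simp: maximal_segments_def)
  \<comment> \<open>Both edges lie in the one segment \<open>g2 \<sigma>\<close>, which has
    direction \<open>z\<close>; so the two tiles are bounded by the same line.\<close>
  have "a \<bullet> y' = cross2 z y"
  proof (rule inner_constant_on_segment)
    show "y \<in> closed_segment h h'" "y + (k * c) *\<^sub>R z \<in> closed_segment h h'" "y' \<in> closed_segment h h'"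
      using k(2) k'(2) y(1) y'(1) h by auto
    show "y \<noteq> y + (k * c) *\<^sub>R z" using k(1) c(1) \<open>z \<noteq> 0\<close> by simp
    show "a \<bullet> y = cross2 z y" "a \<bullet> (y + (k * c) *\<^sub>R z) = cross2 z y"
      by (simp_all add: cross2_simps flip: cr)
  qed
  show ?thesis
  proof (rule that[OF ab, of "cross2 z y"])
    fix x assume "x \<in> f2 s"
    then show "cross2 z y \<le> a \<bullet> x"
      using y(2)[of x] k(1) c(1) by (simp add: cross2_simps zero_le_mult_iff flip: cr)
  next
    fix x assume "x \<in> f2 t"
    then show "a \<bullet> x \<le> cross2 z y"
      using y'(2)[of x] k'(1) c'(1) \<open>a \<bullet> y' = cross2 z y\<close>
      by (simp add: cross2_simps mult_le_0_iff flip: cr)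
  qed
qed

section \<open>Overlaps of combined tiles\<close>

text \<open>The tangent cones of a polytope are closed, so two polytopes meeting in at most one point
  separate at least linearly.\<close>

lemma polytopes_linear_separation:
  fixes K H :: "'a::euclidean_space set"
  assumes K: "polytope K" and H: "polytope H" and int: "K \<inter> H \<subseteq> {p}"
  obtains C where "0 \<le> C" "\<And>a a'. a \<in> K \<Longrightarrow> a' \<in> H \<Longrightarrow> norm (a - p) \<le> C * norm (a - a')"
proof (cases "K \<inter> H = {}")
  case True
  obtain r where r: "0 < r" "\<And>a. a \<in> K \<Longrightarrow> norm a \<le> r"
    using polytope_imp_bounded[OF K] by (auto simp: bounded_pos)
  obtain d where d: "0 < d" "\<And>a a'. a \<in> K \<Longrightarrow> a' \<in> H \<Longrightarrow> d \<le> dist a a'"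
    using separate_compact_closed[OF polytope_imp_compact[OF K] polytope_imp_closed[OF H] True] by metis
  have "norm (a - p) \<le> (r + norm p) / d * norm (a - a')" if "a \<in> K" "a' \<in> H" for a a'
  proof -
    have "norm (a - p) \<le> norm a + norm p" by (rule norm_triangle_ineq4)
    also have "\<dots> \<le> (r + norm p) / d * d" using r(2)[OF that(1)] d(1) by simp
    also have "\<dots> \<le> (r + norm p) / d * norm (a - a')"
      using d(2)[OF that] d(1) r(1) by (intro mult_left_mono) (auto simp: dist_norm)
    finally show ?thesis .
  qed
  then show ?thesis
    using r d by (intro that[of "(r + norm p) / d"]) auto
next
  case False
  then have p: "p \<in> K" "p \<in> H" "K \<inter> H = {p}" using int by auto
  define cone where "cone S = conic hull ((\<lambda>x. x - p) ` S)" for S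
  have cl: "closed (cone S)" if "polytope S" for S
  proof -
    have "(\<lambda>x. x - p) ` S = (+) (- p) ` S" by (rule image_cong) simp_all
    then have "polytope ((\<lambda>x. x - p) ` S)" using that by (simp only: polytope_translation_eq)
    then show ?thesis unfolding cone_def using closed_conic_hull_strong by blast
  qed
  have cone_iff: "y \<in> cone S \<longleftrightarrow> (\<exists>c x. 0 \<le> c \<and> x \<in> S \<and> y = c *\<^sub>R (x - p))" for y S
    unfolding cone_def conic_hull_explicit image_def mem_Collect_eq by auto
  \<comment> \<open>A cone vector scaled down by at least its own factor \<open>c\<close> stays in
    \<open>S\<close>, on the segment from \<open>p\<close> to \<open>x\<close>.\<close>
  have shrink: "p + (1 / M) *\<^sub>R y \<in> S"
    if "polytope S" "p \<in> S" "y = c *\<^sub>R (x - p)" "x \<in> S" "0 \<le> c" "c \<le> M" "0 < M" for S x y c M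
  proof -
    have "(1 - c / M) *\<^sub>R p + (c / M) *\<^sub>R x \<in> S"
      by (rule convexD[OF polytope_imp_convex[OF that(1)]]) (use that in auto)
    moreover have "(1 - c / M) *\<^sub>R p + (c / M) *\<^sub>R x = p + (1 / M) *\<^sub>R y"
      by (simp add: that(3) scaleR_diff_left scaleR_diff_right)
    ultimately show ?thesis by simp
  qed
  have disj: "y = 0" if y: "y \<in> cone K" "y \<in> cone H" for y
  proof -
    obtain c x where c: "0 \<le> c" "x \<in> K" "y = c *\<^sub>R (x - p)" using y(1) cone_iff by blast
    obtain c' x' where c': "0 \<le> c'" "x' \<in> H" "y = c' *\<^sub>R (x' - p)" using y(2) cone_iff by blast
    \<comment> \<open>One scale that serves both representations; the summand \<open>1\<close> keeps
      it positive.\<close>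
    define M where "M = c + c' + 1"
    have M: "c \<le> M" "c' \<le> M" "0 < M" using c(1) c'(1) by (simp_all add: M_def)
    have "p + (1 / M) *\<^sub>R y \<in> K \<inter> H"
      by (rule IntI[OF shrink[OF K p(1) c(3,2,1) M(1,3)] shrink[OF H p(2) c'(3,2,1) M(2,3)]])
    then have "(1 / M) *\<^sub>R y = 0" unfolding p(3) by simp
    then show ?thesis using M(3) by (simp only: scaleR_eq_0_iff) simp
  qed
  \<comment> \<open>By homogeneity the vector on the side of \<open>K\<close> may have norm
    \<open>1\<close>. On the side of \<open>H\<close> the radius \<open>2\<close> suffices, as
    longer vectors have distance at least \<open>1\<close> from the unit sphere; therefore
    \<open>d\<close> is capped at \<open>1\<close>.\<close>
  let ?Q = "(cone K \<inter> sphere 0 1) \<times> (cone H \<inter> cball 0 2)"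
  have Q: "compact ?Q"
    using closed_Int_compact[OF cl[OF K] compact_sphere] closed_Int_compact[OF cl[OF H] compact_cball]
    by (rule compact_Times)
  obtain d where d: "0 < d" "d \<le> 1" "\<And>y y'. (y, y') \<in> ?Q \<Longrightarrow> d \<le> norm (y - y')"
  proof (cases "?Q = {}")
    case True
    show ?thesis
    proof (rule that[of 1])
      show "1 \<le> norm (y - y')" if "(y, y') \<in> ?Q" for y y'
        using that True by blast
    qed simp_all
  next
    case False
    have "continuous_on ?Q (\<lambda>q. norm (fst q - snd q))" by (intro continuous_intros)
    from continuous_attains_inf[OF Q False this]
    obtain q where q: "q \<in> ?Q" "\<And>q'. q' \<in> ?Q \<Longrightarrow> norm (fst q - snd q) \<le> norm (fst q' - snd q')" by blast
    have "fst q \<noteq> snd q"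
    proof
      assume eq: "fst q = snd q"
      have q1: "fst q \<in> cone K" "norm (fst q) = 1" "snd q \<in> cone H"
        using q(1) by (simp_all add: mem_Times_iff)
      then have "fst q = 0" using disj[of "fst q"] eq by simp
      then show False using q1(2) by simp
    qed
    then have pos: "0 < norm (fst q - snd q)" by simp
    show ?thesis
    proof (rule that[of "min 1 (norm (fst q - snd q))"])
      show "min 1 (norm (fst q - snd q)) \<le> norm (y - y')" if "(y, y') \<in> ?Q" for y y'
        using q(2)[OF that] by (simp only: fst_conv snd_conv min.coboundedI2)
    qed (use pos in simp_all)
  qed
  have "norm (a - p) \<le> (1 / d) * norm (a - a')" if a: "a \<in> K" "a' \<in> H" for a a'
  proof (cases "a = p")
    case True
    then show ?thesis using d by simp
  next
    case False
    define r where "r = norm (a - p)"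
    have r: "0 < r" using False by (simp add: r_def)
    define y where "y = (1 / r) *\<^sub>R (a - p)"
    define y' where "y' = (1 / r) *\<^sub>R (a' - p)"
    have y: "y \<in> cone K" "norm y = 1" "y' \<in> cone H"
    proof -
      have "0 \<le> 1 / r" using r by simp
      then show "y \<in> cone K" "y' \<in> cone H"
        unfolding cone_iff y_def y'_def using a by blast+
      show "norm y = 1" using r by (simp add: y_def r_def)
    qed
    have "d \<le> norm (y - y')"
    proof (cases "norm y' \<le> 2")
      case True
      then show ?thesis using d(3)[of y y'] y by simp
    next
      case False
      then show ?thesis using norm_triangle_ineq3[of y y'] y(2) d(2) by linarith
    qed
    also have "y - y' = (1 / r) *\<^sub>R (a - a')"
      by (simp add: y_def y'_def flip: scaleR_diff_right)
    finally have "d \<le> norm (a - a') / r" using r by simp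
    then show ?thesis using r d(1) by (simp add: r_def[symmetric] field_simps)
  qed
  then show ?thesis using d(1) by (intro that[of "1 / d"]) auto
qed

text \<open>A common point of the two combinations comes from points of \<open>K\<close> and
  \<open>H\<close> at distance \<open>O(e)\<close>. By linear separation the point of
  \<open>K\<close> is \<open>O(e)\<close> close to \<open>p\<close>, so the overlap lies in a disc
  of radius \<open>O(e)\<close>.\<close>

lemma mix_overlap_point:
  fixes K H L M :: "(real^2) set"
  assumes K: "polytope K" and H: "polytope H" and int: "K \<inter> H \<subseteq> {p}" and L: "compact L" and M: "compact M"
  obtains C where "\<And>e. 0 < e \<Longrightarrow> e < 1 \<Longrightarrow> measure lborel (mix e K L \<inter> mix e H M) \<le> C * e\<^sup>2"
proof -
  obtain C where C: "0 \<le> C" "\<And>a a'. a \<in> K \<Longrightarrow> a' \<in> H \<Longrightarrow> norm (a - p) \<le> C * norm (a - a')"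
    using polytopes_linear_separation[OF K H int] by metis
  have "bounded (K \<union> H \<union> L \<union> M)"
    using K H L M by (auto intro: polytope_imp_bounded compact_imp_bounded)
  then obtain r where r: "0 < r" "\<And>x. x \<in> K \<union> H \<union> L \<union> M \<Longrightarrow> norm x \<le> r"
    by (auto simp: bounded_pos)
  \<comment> \<open>The first term bounds the distance from \<open>x\<close> to \<open>a\<close>,
    the second that from \<open>a\<close> to \<open>p\<close>, both divided by
    \<open>e\<close>.\<close>
  define \<rho> where "\<rho> = 2 * r + C * (4 * r)"
  have \<rho>: "0 \<le> \<rho>" using r C by (simp add: \<rho>_def)
  have sub: "mix e K L \<inter> mix e H M \<subseteq> cball p (\<rho> * e)" if e: "0 < e" "e < 1" for e
  proof
    fix x assume "x \<in> mix e K L \<inter> mix e H M"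
    then obtain a b a' b' where ab: "a \<in> K" "b \<in> L" "x = (1 - e) *\<^sub>R a + e *\<^sub>R b"
      "a' \<in> H" "b' \<in> M" "x = (1 - e) *\<^sub>R a' + e *\<^sub>R b'"
      by (auto elim!: mixE)
    have bd: "norm a \<le> r" "norm b \<le> r" "norm a' \<le> r" "norm b' \<le> r" using r(2) ab by auto
    have "a - a' = e *\<^sub>R ((a - b) + (b' - a'))"
      using ab(3,6) by (simp add: algebra_simps)
    also have "norm \<dots> \<le> e * ((norm a + norm b) + (norm b' + norm a'))"
      using e by (simp add: order_trans[OF norm_triangle_ineq] add_mono norm_triangle_ineq4)
    also have "\<dots> \<le> e * (4 * r)"
      using e bd by (intro mult_left_mono) auto
    finally have "norm (a - p) \<le> C * (e * (4 * r))"
      using C(2)[OF ab(1,4)] C(1) by (meson mult_left_mono order_trans)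
    moreover have "norm (x - a) \<le> e * (2 * r)"
    proof -
      have "x - a = e *\<^sub>R (b - a)" using ab(3) by (simp add: algebra_simps)
      also have "norm \<dots> \<le> e * (norm b + norm a)" using e by (simp add: norm_triangle_ineq4)
      also have "\<dots> \<le> e * (2 * r)" using e bd by (intro mult_left_mono) auto
      finally show ?thesis .
    qed
    moreover have "norm (x - p) \<le> norm (x - a) + norm (a - p)"
      using norm_triangle_ineq[of "x - a" "a - p"] by simp
    ultimately show "x \<in> cball p (\<rho> * e)"
      by (simp add: \<rho>_def dist_norm norm_minus_commute algebra_simps)
  qed
  have "measure lborel (mix e K L \<inter> mix e H M) \<le> (unit_ball_vol 2 * \<rho>\<^sup>2) * e\<^sup>2" if e: "0 < e" "e < 1" for e
  proof -
    have c: "compact (mix e K L)" "compact (mix e H M)"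
      using K H L M by (auto intro: compact_mix polytope_imp_compact)
    have "measure lborel (mix e K L \<inter> mix e H M) \<le> measure lborel (cball p (\<rho> * e))"
      using c by (intro measure_mono_fmeasurable sub[OF e] fmeasurable_compact fmeasurableD compact_Int) auto
    also have "\<dots> = (unit_ball_vol 2 * \<rho>\<^sup>2) * e\<^sup>2"
      using \<rho> e by (simp add: content_cball power_mult_distrib)
    finally show ?thesis .
  qed
  then show ?thesis using that by blast
qed

text \<open>Separating lines with a common normal combine to a separating line of the combinations,
  and the overlap lies on it.\<close>

lemma mix_overlap_separated:
  fixes K H L M :: "'a::euclidean_space set"
  assumes u: "u \<noteq> 0" and e: "0 < e" "e < 1"
    and "\<And>x. x \<in> K \<Longrightarrow> b1 \<le> u \<bullet> x" "\<And>x. x \<in> H \<Longrightarrow> u \<bullet> x \<le> b1"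
    and "\<And>x. x \<in> L \<Longrightarrow> b2 \<le> u \<bullet> x" "\<And>x. x \<in> M \<Longrightarrow> u \<bullet> x \<le> b2"
  shows "measure lborel (mix e K L \<inter> mix e H M) = 0"
proof -
  let ?b = "(1 - e) * b1 + e * b2"
  have "?b \<le> u \<bullet> x" if "x \<in> mix e K L" for x
    using that e assms by (auto elim!: mixE simp: inner_add_right intro!: add_mono mult_left_mono)
  moreover have "u \<bullet> x \<le> ?b" if "x \<in> mix e H M" for x
    using that e assms by (auto elim!: mixE simp: inner_add_right intro!: add_mono mult_left_mono)
  ultimately have "mix e K L \<inter> mix e H M \<subseteq> {x. u \<bullet> x = ?b}"
    by (force intro: antisym)
  then have "emeasure lborel (mix e K L \<inter> mix e H M) = 0"
    using hyperplane_null_sets_lborel[OF u, of ?b] by (metis emeasure_eq_0 null_setsD1 null_setsD2)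
  then show ?thesis by (simp add: measure_def)
qed

text \<open>The estimate holds pointwise: at a covered point one set \<open>N i\<close> accounts for
  the value of \<open>\<phi>\<close> over \<open>R\<close>, and every further set containing the
  point contributes at most \<open>B\<close>, charged to its overlap with
  \<open>N i\<close>.\<close>

lemma sum_set_integral_overlap:
  fixes N :: "'i \<Rightarrow> (real^2) set" and \<phi> :: "real^2 \<Rightarrow> real"
  assumes I: "finite I" and N: "\<And>i. i \<in> I \<Longrightarrow> compact (N i)" "\<And>i. i \<in> I \<Longrightarrow> N i \<subseteq> R" and R: "compact R"
    and \<phi>: "continuous_on R \<phi>" "\<And>x. x \<in> R \<Longrightarrow> 0 \<le> \<phi> x" "\<And>x. x \<in> R \<Longrightarrow> \<phi> x \<le> B" and B: "0 \<le> B"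
  shows "(\<Sum>i\<in>I. LINT x:N i|lborel. \<phi> x) \<le> (LINT x:R|lborel. \<phi> x)
    + B * (\<Sum>i\<in>I. \<Sum>j\<in>I - {i}. measure lborel (N j \<inter> N i))"
proof -
  have intN: "integrable lborel (\<lambda>x. indicator (N i) x *\<^sub>R \<phi> x)" if "i \<in> I" for i
    using that N \<phi>(1) by (intro borel_integrable_compact) (auto intro: continuous_on_subset)
  have intR: "integrable lborel (\<lambda>x. indicator R x *\<^sub>R \<phi> x)"
    using R \<phi>(1) by (rule borel_integrable_compact)
  have intO: "integrable lborel (indicator (N j \<inter> N i) :: _ \<Rightarrow> real)" if "i \<in> I" "j \<in> I" for i j
    using fmeasurable_compact[OF compact_Int[OF N(1) N(1)], of j i] that
    by (auto simp: fmeasurable_def)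
  have "(\<Sum>i\<in>I. LINT x:N i|lborel. \<phi> x) = (LINT x|lborel. (\<Sum>i\<in>I. indicator (N i) x *\<^sub>R \<phi> x))"
    using intN by (simp add: set_lebesgue_integral_def Bochner_Integration.integral_sum)
  also have "\<dots> \<le> (LINT x|lborel. indicator R x *\<^sub>R \<phi> x + B * (\<Sum>i\<in>I. \<Sum>j\<in>I - {i}. indicator (N j \<inter> N i) x))"
  proof (rule integral_mono)
    show "integrable lborel (\<lambda>x. \<Sum>i\<in>I. indicator (N i) x *\<^sub>R \<phi> x)"
      by (intro Bochner_Integration.integrable_sum intN)
    show "integrable lborel (\<lambda>x. indicator R x *\<^sub>R \<phi> x + B * (\<Sum>i\<in>I. \<Sum>j\<in>I - {i}. indicator (N j \<inter> N i) x))"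
      by (intro Bochner_Integration.integrable_add intR integrable_mult_right Bochner_Integration.integrable_sum intO) auto
    fix x
    let ?O = "\<lambda>i. \<Sum>j\<in>I - {i}. indicator (N j \<inter> N i) x :: real"
    have O: "0 \<le> ?O i" for i by (intro sum_nonneg) auto
    show "(\<Sum>i\<in>I. indicator (N i) x *\<^sub>R \<phi> x) \<le> indicator R x *\<^sub>R \<phi> x + B * (\<Sum>i\<in>I. ?O i)"
    proof (cases "\<exists>i\<in>I. x \<in> N i")
      case True
      then obtain i where i: "i \<in> I" "x \<in> N i" by blast
      then have x: "x \<in> R" using N(2) by blast
      have "(\<Sum>j\<in>I. indicator (N j) x *\<^sub>R \<phi> x) = \<phi> x + (\<Sum>j\<in>I - {i}. indicator (N j) x *\<^sub>R \<phi> x)"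
        using i(2) by (subst sum.remove[OF I i(1)]) simp
      also have "\<dots> \<le> \<phi> x + (\<Sum>j\<in>I - {i}. B * indicator (N j \<inter> N i) x)"
        using i \<phi>(3)[OF x] by (intro add_left_mono sum_mono) (auto simp: indicator_def)
      also have "\<dots> = \<phi> x + B * ?O i" by (simp add: sum_distrib_left)
      also have "\<dots> \<le> \<phi> x + B * (\<Sum>i\<in>I. ?O i)"
        using i I O B by (intro add_left_mono mult_left_mono member_le_sum) auto
      finally show ?thesis using x by simp
    next
      case False
      then have "(\<Sum>i\<in>I. indicator (N i) x *\<^sub>R \<phi> x) = 0" by (intro sum.neutral) auto
      moreover have "0 \<le> indicator R x *\<^sub>R \<phi> x" using \<phi>(2)[of x] by (auto simp: indicator_def)
      ultimately show ?thesis using O B by (simp add: sum_nonneg)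
    qed
  qed
  also have "\<dots> = (LINT x:R|lborel. \<phi> x) + B * (\<Sum>i\<in>I. \<Sum>j\<in>I - {i}. measure lborel (N j \<inter> N i))"
  proof -
    have iS: "integrable lborel (\<lambda>x. \<Sum>j\<in>I - {i}. indicator (N j \<inter> N i) x :: real)" if "i \<in> I" for i
      using that by (intro Bochner_Integration.integrable_sum intO) auto
    have "(LINT x|lborel. (\<Sum>i\<in>I. \<Sum>j\<in>I - {i}. indicator (N j \<inter> N i) x :: real))
        = (\<Sum>i\<in>I. \<Sum>j\<in>I - {i}. LINT x|lborel. indicator (N j \<inter> N i) x)"
      using iS intO by (simp add: Bochner_Integration.integral_sum)
    then show ?thesis
      using iS intR by (subst Bochner_Integration.integral_add)
        (auto simp: set_lebesgue_integral_def Bochner_Integration.integrable_sum)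
  qed
  finally show ?thesis .
qed

section \<open>Integrals over translated bodies and over tilings\<close>

lemma mix_self:
  assumes "convex K" "0 \<le> e" "e \<le> 1"
  shows "mix e K K = K"
proof
  show "mix e K K \<subseteq> K"
    using assms by (intro mix_subset_convex) auto
  show "K \<subseteq> mix e K K"
  proof
    fix x assume "x \<in> K"
    then have "(1 - e) *\<^sub>R x + e *\<^sub>R x \<in> mix e K K" by (intro mixI)
    then show "x \<in> mix e K K" by (simp flip: scaleR_add_left)
  qed
qed

lemma mix_translate:
  assumes "convex K" "0 \<le> e" "e \<le> 1"
  shows "mix e K ((\<lambda>x. x + w) ` K) = (\<lambda>x. x + e *\<^sub>R w) ` K"
proof -
  have "mix e K ((\<lambda>x. x + w) ` K) = (\<lambda>x. x + e *\<^sub>R w) ` mix e K K"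
    by (force simp: mix_def algebra_simps)
  then show ?thesis using mix_self[OF assms] by simp
qed

lemma set_integral_translate:
  fixes f :: "'a::euclidean_space \<Rightarrow> real"
  assumes [measurable]: "f \<in> borel_measurable borel" and K: "compact K"
  shows "(LINT x:(\<lambda>x. x + v) ` K|lborel. f x) = (LINT x:K|lborel. f (x + v))"
proof -
  have c: "compact ((\<lambda>x. x + v) ` K)"
    using K by (intro compact_continuous_image continuous_intros)
  then have [measurable]: "(\<lambda>x. x + v) ` K \<in> sets borel" by (rule borel_compact)
  have "(LINT x:(\<lambda>x. x + v) ` K|lborel. f x)
      = (LINT x|distr lborel borel ((+) v). indicator ((\<lambda>x. x + v) ` K) x *\<^sub>R f x)"
    by (simp add: lborel_distr_plus set_lebesgue_integral_def)
  also have "\<dots> = (LINT x|lborel. indicator ((\<lambda>x. x + v) ` K) (v + x) *\<^sub>R f (v + x))"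
    by (rule integral_distr) measurable
  also have "\<dots> = (LINT x:K|lborel. f (x + v))"
    unfolding set_lebesgue_integral_def
    by (intro Bochner_Integration.integral_cong) (auto simp: indicator_def add.commute)
  finally show ?thesis .
qed

lemma measure_eq_set_integral_1:
  fixes S :: "'a::euclidean_space set"
  assumes "compact S"
  shows "measure lborel S = (LINT x:S|lborel. (1::real))"
  using assms by (subst set_integral_const) (auto simp: borel_compact emeasure_compact_eq_measure)

text \<open>One inequality is the overlap estimate, where distinct tiles overlap only on a line; the
  other holds pointwise because the tiles cover \<open>R\<close>.\<close>

lemma set_integral_tiling:
  fixes \<phi> :: "real^2 \<Rightarrow> real"
  assumes T: "tiling R T" and R: "compact R"
    and \<phi>: "continuous_on R \<phi>" "\<And>x. x \<in> R \<Longrightarrow> 0 \<le> \<phi> x" "\<And>x. x \<in> R \<Longrightarrow> \<phi> x \<le> B" and B: "0 \<le> B"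
  shows "(\<Sum>t\<in>T. LINT x:t|lborel. \<phi> x) = (LINT x:R|lborel. \<phi> x)"
proof (rule antisym)
  note Td = tilingD[OF T]
  have cp: "compact t" "convex t" "interior t \<noteq> {}" if "t \<in> T" for t
    using convex_polygonD[OF Td(2)[OF that]] by auto
  have "measure lborel (s \<inter> t) = 0" if st: "s \<in> T" "t \<in> T" "s \<noteq> t" for s t
  proof -
    obtain a b where ab: "a \<noteq> 0" "\<And>x. x \<in> s \<Longrightarrow> b \<le> a \<bullet> x" "\<And>x. x \<in> t \<Longrightarrow> a \<bullet> x \<le> b"
      using interior_disjoint_separated[OF cp[OF st(1)] cp[OF st(2)] Td(5)[OF st]] by metis
    then have "s \<inter> t \<subseteq> {x. a \<bullet> x = b}" by (force intro: antisym)
    then have "emeasure lborel (s \<inter> t) = 0"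
      using hyperplane_null_sets_lborel[OF ab(1), of b] by (metis emeasure_eq_0 null_setsD1 null_setsD2)
    then show ?thesis by (simp add: measure_def)
  qed
  then have "(\<Sum>i\<in>T. \<Sum>j\<in>T - {i}. measure lborel (j \<inter> i)) = 0"
    by (intro sum.neutral ballI) auto
  then show "(\<Sum>t\<in>T. LINT x:t|lborel. \<phi> x) \<le> (LINT x:R|lborel. \<phi> x)"
    using sum_set_integral_overlap[of T "\<lambda>t. t" R \<phi> B] Td(1,4) cp(1) R \<phi> B by simp
  have intt: "integrable lborel (\<lambda>x. indicator t x *\<^sub>R \<phi> x)" if "t \<in> T" for t
    using cp(1)[OF that] continuous_on_subset[OF \<phi>(1) Td(4)[OF that]] by (rule borel_integrable_compact)
  have "(LINT x:R|lborel. \<phi> x) \<le> (LINT x|lborel. (\<Sum>t\<in>T. indicator t x *\<^sub>R \<phi> x))"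
    unfolding set_lebesgue_integral_def
  proof (rule integral_mono)
    show "integrable lborel (\<lambda>x. indicator R x *\<^sub>R \<phi> x)"
      using R \<phi>(1) by (rule borel_integrable_compact)
    show "integrable lborel (\<lambda>x. \<Sum>t\<in>T. indicator t x *\<^sub>R \<phi> x)"
      by (intro Bochner_Integration.integrable_sum intt)
    fix x
    have nonneg: "0 \<le> indicator t x *\<^sub>R \<phi> x" if "t \<in> T" for t
      using that Td(4) \<phi>(2) by (auto simp: indicator_def)
    show "indicator R x *\<^sub>R \<phi> x \<le> (\<Sum>t\<in>T. indicator t x *\<^sub>R \<phi> x)"
    proof (cases "x \<in> R")
      case True
      then obtain t where t: "t \<in> T" "x \<in> t" using Td(3) by blast
      then have "indicator R x *\<^sub>R \<phi> x = indicator t x *\<^sub>R \<phi> x" using True by simp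
      also have "\<dots> \<le> (\<Sum>t\<in>T. indicator t x *\<^sub>R \<phi> x)"
        using t nonneg Td(1) by (intro member_le_sum) auto
      finally show ?thesis .
    next
      case False
      then show ?thesis using nonneg by (simp add: sum_nonneg)
    qed
  qed
  also have "\<dots> = (\<Sum>t\<in>T. LINT x:t|lborel. \<phi> x)"
    using intt by (simp add: set_lebesgue_integral_def Bochner_Integration.integral_sum)
  finally show "(LINT x:R|lborel. \<phi> x) \<le> (\<Sum>t\<in>T. LINT x:t|lborel. \<phi> x)" .
qed

text \<open>Two tiles with two common points fall under
  \<open>tiles_opposite_sides_transfer\<close>, and their combinations overlap in a null set. All
  other pairs meet in at most one point and contribute \<open>O(e)\<close> squared. The constants
  are summed over the finitely many pairs.\<close>

lemma tiling_mix_overlap: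
  assumes T: "tiling R T"
    and T1: "tiling R T1" "combinatorial_equivalence R T T1 f1 g1" "same_orientations T f1 g1"
    and T2: "tiling R T2" "combinatorial_equivalence R T T2 f2 g2" "same_orientations T f2 g2"
  obtains C where "\<And>e. 0 < e \<Longrightarrow> e < 1 \<Longrightarrow>
    (\<Sum>s\<in>T. \<Sum>t\<in>T - {s}. measure lborel (mix e (f1 t) (f2 t) \<inter> mix e (f1 s) (f2 s))) \<le> C * e\<^sup>2"
proof -
  let ?N = "\<lambda>e t. mix e (f1 t) (f2 t)"
  have f: "f1 t \<in> T1" "f2 t \<in> T2" if "t \<in> T" for t
    using that T1(2) T2(2) by (auto simp: combinatorial_equivalence_def bij_betw_def)
  have poly: "convex_polygon (f1 t)" "convex_polygon (f2 t)" if "t \<in> T" for t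
    using f[OF that] tilingD(2)[OF T1(1)] tilingD(2)[OF T2(1)] by auto
  have "\<exists>C. \<forall>e. 0 < e \<and> e < 1 \<longrightarrow> measure lborel (?N e t \<inter> ?N e s) \<le> C * e\<^sup>2"
    if st: "s \<in> T" "t \<in> T" "t \<noteq> s" for s t
  proof (cases "\<exists>p q. p \<in> f1 t \<inter> f1 s \<and> q \<in> f1 t \<inter> f1 s \<and> p \<noteq> q")
    case True
    then obtain p q where "p \<in> f1 t \<inter> f1 s" "q \<in> f1 t \<inter> f1 s" "p \<noteq> q" by blast
    from tiles_opposite_sides_transfer[OF T T1 T2 st(2,1,3) this]
    obtain u b1 b2 where "u \<noteq> 0" "\<And>x. x \<in> f1 t \<Longrightarrow> b1 \<le> u \<bullet> x" "\<And>x. x \<in> f1 s \<Longrightarrow> u \<bullet> x \<le> b1"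
      "\<And>x. x \<in> f2 t \<Longrightarrow> b2 \<le> u \<bullet> x" "\<And>x. x \<in> f2 s \<Longrightarrow> u \<bullet> x \<le> b2" by blast
    then have "measure lborel (?N e t \<inter> ?N e s) = 0" if "0 < e" "e < 1" for e
      using that by (intro mix_overlap_separated) auto
    then show ?thesis by (intro exI[of _ 0]) auto
  next
    case False
    then obtain p where "f1 t \<inter> f1 s \<subseteq> {p}" by blast
    then show ?thesis
      using mix_overlap_point[of "f1 t" "f1 s" p "f2 t" "f2 s"] convex_polygonD[OF poly(1)] convex_polygonD[OF poly(2)] st
      by metis
  qed
  then obtain C where C: "\<And>s t e. s \<in> T \<Longrightarrow> t \<in> T \<Longrightarrow> t \<noteq> s \<Longrightarrow> 0 < e \<Longrightarrow> e < 1
      \<Longrightarrow> measure lborel (?N e t \<inter> ?N e s) \<le> C s t * e\<^sup>2"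
    by metis
  have "(\<Sum>s\<in>T. \<Sum>t\<in>T - {s}. measure lborel (?N e t \<inter> ?N e s)) \<le> (\<Sum>s\<in>T. \<Sum>t\<in>T - {s}. C s t) * e\<^sup>2"
    if "0 < e" "e < 1" for e
    unfolding sum_distrib_right using that by (intro sum_mono C) auto
  then show ?thesis using that by blast
qed

section \<open>Rigidity of a tiling with prescribed tile areas\<close>

theorem theorem5:
  fixes R :: "(real^2) set" and T T1 T2 :: "(real^2) set set"
    and f1 g1 f2 g2 :: "(real^2) set \<Rightarrow> (real^2) set"
    and area :: "(real^2) set \<Rightarrow> real"
  assumes "convex_polygon R" and "tiling R T" and "nondegenerate R T"
    and "tiling R T1" and "combinatorial_equivalence R T T1 f1 g1"
    and "same_edge_directions T f1 g1" and "same_orientations T f1 g1"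
    and "\<forall>t\<in>T. measure lebesgue (f1 t) = area t"
    and "tiling R T2" and "combinatorial_equivalence R T T2 f2 g2"
    and "same_edge_directions T f2 g2" and "same_orientations T f2 g2"
    and "\<forall>t\<in>T. measure lebesgue (f2 t) = area t"
  shows "T1 = T2 \<and> (\<forall>t\<in>T. f1 t = f2 t)"
proof -
  have R: "compact R" "convex R" using convex_polygonD[OF assms(1)] by auto
  have fin: "finite T" by (rule tilingD(1)[OF assms(2)])
  have bij: "bij_betw f1 T T1" "bij_betw f2 T T2"
    using assms(5,10) by (auto simp: combinatorial_equivalence_def)
  have f: "f1 t \<in> T1" "f2 t \<in> T2" if "t \<in> T" for t
    using that bij by (auto simp: bij_betw_def)
  have poly: "convex_polygon (f1 t)" "convex_polygon (f2 t)" if "t \<in> T" for t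
    using f[OF that] tilingD(2)[OF assms(4)] tilingD(2)[OF assms(9)] by auto
  note cp = convex_polygonD[OF poly(1)] convex_polygonD[OF poly(2)]
  have sub: "f1 t \<subseteq> R" "f2 t \<subseteq> R" if "t \<in> T" for t
    using f[OF that] tilingD(4)[OF assms(4)] tilingD(4)[OF assms(9)] by auto
  have area: "measure lborel (f1 t) = area t" "measure lborel (f2 t) = area t" if "t \<in> T" for t
    using that assms(8,13) cp by (simp_all add: borel_compact)
  have pos: "0 < area t" if "t \<in> T" for t
  proof -
    have "\<not> negligible (f1 t)"
      using negligible_convex_interior[OF cp(2)[OF that]] cp(4)[OF that] by simp
    then have "measure lebesgue (f1 t) \<noteq> 0"
      using lmeasurable_compact[OF cp(1)[OF that]] by (simp add: negligible_iff_measure)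
    then show ?thesis
      using bspec[OF assms(8) that] measure_nonneg[of lebesgue "f1 t"] by linarith
  qed
  let ?N = "\<lambda>e t. mix e (f1 t) (f2 t)"
  obtain C where C: "\<And>e. 0 < e \<Longrightarrow> e < 1 \<Longrightarrow>
      (\<Sum>s\<in>T. \<Sum>t\<in>T - {s}. measure lborel (?N e t \<inter> ?N e s)) \<le> C * e\<^sup>2"
    using tiling_mix_overlap[OF assms(2,4,5,7,9,10,12)] by blast
  \<comment> \<open>Kept general in the weight: the constant \<open>1\<close> gives the estimate for
    areas, and the quadratic weight defined below fixes the translations.\<close>
  have sum_N: "(\<Sum>t\<in>T. LINT x:?N e t|lborel. \<phi> x) \<le> (\<Sum>t\<in>T. LINT x:f1 t|lborel. \<phi> x) + B * C * e\<^sup>2"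
    and sum_f: "(\<Sum>t\<in>T. LINT x:f1 t|lborel. \<phi> x) = (\<Sum>t\<in>T. LINT x:f2 t|lborel. \<phi> x)"
    if \<phi>: "continuous_on R \<phi>" "\<And>x. x \<in> R \<Longrightarrow> 0 \<le> \<phi> x" "\<And>x. x \<in> R \<Longrightarrow> \<phi> x \<le> B" "0 \<le> B"
      and e: "0 < e" "e < 1" for \<phi> :: "real^2 \<Rightarrow> real" and B e
  proof -
    have eqR: "(\<Sum>t\<in>T. LINT x:f1 t|lborel. \<phi> x) = (LINT x:R|lborel. \<phi> x)"
      "(\<Sum>t\<in>T. LINT x:f2 t|lborel. \<phi> x) = (LINT x:R|lborel. \<phi> x)"
      using set_integral_tiling[OF assms(4) R(1) \<phi>] set_integral_tiling[OF assms(9) R(1) \<phi>]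
      by (simp_all only: sum.reindex_bij_betw[OF bij(1), of "\<lambda>k. LINT x:k|lborel. \<phi> x", symmetric]
          sum.reindex_bij_betw[OF bij(2), of "\<lambda>k. LINT x:k|lborel. \<phi> x", symmetric])
    then show "(\<Sum>t\<in>T. LINT x:f1 t|lborel. \<phi> x) = (\<Sum>t\<in>T. LINT x:f2 t|lborel. \<phi> x)" by simp
    have "(\<Sum>t\<in>T. LINT x:?N e t|lborel. \<phi> x) \<le> (LINT x:R|lborel. \<phi> x)
        + B * (\<Sum>s\<in>T. \<Sum>t\<in>T - {s}. measure lborel (?N e t \<inter> ?N e s))"
      using cp sub e by (intro sum_set_integral_overlap fin compact_mix mix_subset_convex R \<phi>) auto
    also have "\<dots> \<le> (LINT x:R|lborel. \<phi> x) + B * (C * e\<^sup>2)"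
      using C[OF e] \<phi>(4) by (intro add_left_mono mult_left_mono)
    finally show "(\<Sum>t\<in>T. LINT x:?N e t|lborel. \<phi> x) \<le> (\<Sum>t\<in>T. LINT x:f1 t|lborel. \<phi> x) + B * C * e\<^sup>2"
      unfolding eqR by (simp add: mult.assoc)
  qed
  have "mix_stationary (f1 t) (f2 t)" if t: "t \<in> T" for t
  proof -
    have ge: "measure lborel (f1 s) \<le> measure lborel (?N e s)" if "s \<in> T" "0 < e" "e < 1" for s e
      using that cp area pos by (intro measure_mix_ge) auto
    have "measure lborel (?N e t) \<le> measure lborel (f1 t) + C * e\<^sup>2" if e: "0 < e" "e < 1" for e
    proof -
      have "(\<Sum>t\<in>T. measure lborel (?N e t)) \<le> (\<Sum>t\<in>T. measure lborel (f1 t)) + C * e\<^sup>2"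
        using sum_N[of "\<lambda>_. 1" 1, OF _ _ _ _ e] cp
        by (simp add: measure_eq_set_integral_1 compact_mix)
      \<comment> \<open>No other tile loses area, so the bound for the total excess applies to the
        single tile \<open>t\<close>.\<close>
      moreover have "(\<Sum>s\<in>T - {t}. measure lborel (f1 s)) \<le> (\<Sum>s\<in>T - {t}. measure lborel (?N e s))"
        using ge e by (intro sum_mono) auto
      ultimately show ?thesis
        using fin t by (simp add: sum.remove)
    qed
    then show ?thesis
      unfolding mix_stationary_def using t cp area pos by auto
  qed
  then have "\<exists>w. f2 t = (\<lambda>x. x + w) ` f1 t" if "t \<in> T" for t
    using that by (intro mix_stationary_translate)
  then obtain w where w: "\<And>t. t \<in> T \<Longrightarrow> f2 t = (\<lambda>x. x + w t) ` f1 t"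
    by metis
  obtain r where r: "0 < r" "\<And>x. x \<in> R \<Longrightarrow> norm x \<le> r"
    using compact_imp_bounded[OF R(1)] by (auto simp: bounded_pos)
  \<comment> \<open>The radius \<open>r\<close> keeps the weight between \<open>0\<close> and its
    square on \<open>R\<close>. The strictly concave quadratic part detects translations at second
    order.\<close>
  define \<phi> where "\<phi> x = r\<^sup>2 - x \<bullet> x" for x :: "real^2"
  have \<phi>: "continuous_on S \<phi>" "\<And>x. x \<in> R \<Longrightarrow> 0 \<le> \<phi> x" "\<And>x. x \<in> R \<Longrightarrow> \<phi> x \<le> r\<^sup>2" "0 \<le> r\<^sup>2" for S
    unfolding \<phi>_def using r by (auto intro!: continuous_intros power_mono simp flip: power2_norm_eq_inner)
  define P where "P = (\<Sum>t\<in>T. LINT x:f1 t|lborel. x \<bullet> w t)"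
  define Q where "Q = (\<Sum>t\<in>T. area t * (w t \<bullet> w t))"
  define F where "F e = (\<Sum>t\<in>T. LINT x:(\<lambda>x. x + e *\<^sub>R w t) ` f1 t|lborel. \<phi> x)" for e
  have F: "F e = F 0 - 2 * e * P - e\<^sup>2 * Q" for e
  proof -
    have "(LINT x:(\<lambda>x. x + e *\<^sub>R w t) ` f1 t|lborel. \<phi> x)
        = (LINT x:f1 t|lborel. \<phi> x) - 2 * e * (LINT x:f1 t|lborel. x \<bullet> w t) - e\<^sup>2 * (area t * (w t \<bullet> w t))"
      if t: "t \<in> T" for t
    proof -
      have i: "set_integrable lborel (f1 t) g" if "continuous_on UNIV g" for g :: "real^2 \<Rightarrow> real"
        using cp(1)[OF t] that by (intro integrable_compact_continuous) (auto intro: continuous_on_subset)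
      have "(LINT x:(\<lambda>x. x + e *\<^sub>R w t) ` f1 t|lborel. \<phi> x) = (LINT x:f1 t|lborel. \<phi> (x + e *\<^sub>R w t))"
        using cp(1)[OF t] by (intro set_integral_translate borel_measurable_continuous_onI \<phi>)
      also have "\<dots> = (LINT x:f1 t|lborel. \<phi> x - 2 * e * (x \<bullet> w t) - e\<^sup>2 * (w t \<bullet> w t))"
        by (intro set_lebesgue_integral_cong)
          (use cp(1)[OF t] in \<open>auto simp: borel_compact \<phi>_def inner_add inner_commute algebra_simps power2_eq_square\<close>)
      also have "\<dots> = (LINT x:f1 t|lborel. \<phi> x) - 2 * e * (LINT x:f1 t|lborel. x \<bullet> w t)
          - (LINT x:f1 t|lborel. e\<^sup>2 * (w t \<bullet> w t))"
        by (subst set_integral_diff, (intro i set_integral_diff continuous_intros \<phi>)+)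
           (subst set_integral_diff, (intro i continuous_intros \<phi>)+, simp)
      also have "(LINT x:f1 t|lborel. e\<^sup>2 * (w t \<bullet> w t)) = area t * (e\<^sup>2 * (w t \<bullet> w t))"
        using cp(1)[OF t] area(1)[OF t]
        by (subst set_integral_const) (auto simp: borel_compact emeasure_compact_eq_measure)
      finally show ?thesis by (simp add: mult_ac)
    qed
    then have "F e = (\<Sum>t\<in>T. LINT x:f1 t|lborel. \<phi> x) - 2 * e * P - e\<^sup>2 * Q"
      by (simp add: F_def P_def Q_def sum_subtractf sum_distrib_left)
    then show ?thesis by (simp add: F_def)
  qed
  \<comment> \<open>At \<open>e = 1\<close> the translated tiles are those of the second tiling. The
    value \<open>1/2\<close> only fulfils the side conditions on \<open>e\<close> shared with
    \<open>sum_N\<close>.\<close>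
  have "F 1 = F 0"
    using sum_f[OF \<phi>, of "1/2"] w by (simp add: F_def)
  then have PQ: "2 * P = - Q" using F[of 1] by simp
  \<comment> \<open>Eliminating \<open>P\<close> gives \<open>F e - F 0 = e * (1 - e) * Q\<close>, a
    first-order gain against the second-order overlap bound.\<close>
  have "Q \<le> 0"
  proof (rule first_order_nonpos)
    fix e :: real assume e: "0 < e" "e < 1"
    have "?N e t = (\<lambda>x. x + e *\<^sub>R w t) ` f1 t" if "t \<in> T" for t
      unfolding w[OF that] using cp(2)[OF that] e by (intro mix_translate) auto
    then have "F e \<le> F 0 + r\<^sup>2 * C * e\<^sup>2"
      using sum_N[OF \<phi> e] by (simp add: F_def)
    moreover have "F e = F 0 + e * Q - e\<^sup>2 * Q"
    proof -
      have "2 * e * P = - (e * Q)" using arg_cong[OF PQ, of "\<lambda>x. e * x"] by (simp add: mult_ac)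
      then show ?thesis using F[of e] by simp
    qed
    ultimately have "e * ((1 - e) * Q) \<le> e * (r\<^sup>2 * C * e)"
      by (simp add: algebra_simps power2_eq_square)
    then show "(1 - e) * Q \<le> r\<^sup>2 * C * e" using e by simp
  qed
  moreover have "0 \<le> area t * (w t \<bullet> w t)" if "t \<in> T" for t using pos[OF that] by simp
  moreover from this have "0 \<le> Q" unfolding Q_def by (rule sum_nonneg)
  ultimately have "\<forall>t\<in>T. area t * (w t \<bullet> w t) = 0"
    using sum_nonneg_eq_0_iff[OF fin, of "\<lambda>t. area t * (w t \<bullet> w t)"] by (simp add: Q_def)
  then have w0: "w t = 0" if "t \<in> T" for t
    using that pos[OF that] by auto
  have eq: "f1 t = f2 t" if "t \<in> T" for t
    unfolding w[OF that] w0[OF that] by simp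
  have "T1 = f1 ` T" "T2 = f2 ` T"
    using bij by (simp_all add: bij_betw_def)
  then have "T1 = T2" using image_cong[OF refl eq, of T] by simp
  then show ?thesis using eq by blast
qed

end
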